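(* Let $c\in\{-1,+1\}$, let $f\in C^1(\mathbb{R},\mathbb{R})$ with $f'>0$ on $\mathbb{R}$ and $f(0)=0$, and let $g:\mathbb{R}\to\mathbb{R}$ be Borel measurable with $|g(y)|\le \gamma\,|f(y)|$ for all $y\in\mathbb{R}$, where $0\le\gamma<1$ is a constant. Let $y_0\in H^1((-1,0),\mathbb{R})$ and let $y\in H^1_{loc}((-1,+\infty),\mathbb{R})$ be the solution of $$y'(t)+c\,y'(t-1)+f(y(t))+g(y(t-1))=0,\quad t>0,\qquad y(t)=y_0(t),\quad -1<t<0 .$$ For $t>0$ set $$E(t)=\int_{t-1}^t\bigl(y'(\tau)+f(y(\tau))\bigr)^2\,d\tau\ \ge 0 ,\qquad F(y)=\int_0^y f(z)\,dz .$$ Then $$\sup_{t>0}E(t)+\sup_{t>0}F(y(t))+\int_0^{+\infty}f(y(t))^2\,dt<+\infty ,$$ and consequently $\displaystyle\lim_{t\to+\infty}y(t)=0$ (asymptotic stability of the origin).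
   Context: The equation is a neutral delay differential equation with delay $1$; it is understood to hold for almost every $t>0$ (derivatives are weak derivatives). Functions in $H^1_{loc}$ are identified with their continuous representatives. *)

theory Defs
  imports "HOL-Analysis.Analysis"
begin

text \<open>
  Functions on an open set \<open>I\<close> are represented by total functions of which only the values on
  \<open>I\<close> matter.  Sobolev functions are integrated against the complete measure \<^const>\<open>lebesgue\<close>
  rather than \<^const>\<open>lborel\<close>, so that a weak derivative may be an arbitrary Lebesgue measurable
  representative.
\<close>

definition test_function_on :: "real set \<Rightarrow> (real \<Rightarrow> real) \<Rightarrow> bool" where
  "test_function_on I \<phi> \<longleftrightarrow>
     (\<forall>n. (deriv ^^ n) \<phi> differentiable_on UNIV) \<and>
     compact (closure {x. \<phi> x \<noteq> 0}) \<and> closure {x. \<phi> x \<noteq> 0} \<subseteq> I"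

definition L1_loc :: "real set \<Rightarrow> (real \<Rightarrow> real) \<Rightarrow> bool" where
  "L1_loc I u \<longleftrightarrow> (\<forall>K. compact K \<and> K \<subseteq> I \<longrightarrow> set_integrable lebesgue K u)"

definition L2_on :: "real set \<Rightarrow> (real \<Rightarrow> real) \<Rightarrow> bool" where
  "L2_on S u \<longleftrightarrow>
     set_borel_measurable lebesgue S u \<and> set_integrable lebesgue S (\<lambda>x. (u x)\<^sup>2)"

definition L2_loc :: "real set \<Rightarrow> (real \<Rightarrow> real) \<Rightarrow> bool" where
  "L2_loc I u \<longleftrightarrow> (\<forall>K. compact K \<and> K \<subseteq> I \<longrightarrow> L2_on K u)"

definition weak_derivative_on :: "real set \<Rightarrow> (real \<Rightarrow> real) \<Rightarrow> (real \<Rightarrow> real) \<Rightarrow> bool" where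
  "weak_derivative_on I u v \<longleftrightarrow> L1_loc I u \<and> L1_loc I v \<and>
     (\<forall>\<phi>. test_function_on I \<phi> \<longrightarrow>
        (LINT x:I|lebesgue. u x * deriv \<phi> x) = - (LINT x:I|lebesgue. v x * \<phi> x))"

text \<open>
  The continuity clauses in the two definitions below implement the identification of a Sobolev
  function of one variable with its continuous representative.
\<close>

definition H1_on :: "real set \<Rightarrow> (real \<Rightarrow> real) \<Rightarrow> bool" where
  "H1_on I u \<longleftrightarrow> continuous_on I u \<and> L2_on I u \<and> (\<exists>v. weak_derivative_on I u v \<and> L2_on I v)"

definition H1_loc :: "real set \<Rightarrow> (real \<Rightarrow> real) \<Rightarrow> bool" where
  "H1_loc I u \<longleftrightarrow> continuous_on I u \<and> L2_loc I u \<and> (\<exists>v. weak_derivative_on I u v \<and> L2_loc I v)"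

text \<open>
  In the next definition \<open>y'\<close> is a weak derivative of \<open>y\<close>.  The integral of the nonnegative
  integrand is taken in \<^typ>\<open>ennreal\<close>, so that its finiteness is not built in.
\<close>

definition energy :: "(real \<Rightarrow> real) \<Rightarrow> (real \<Rightarrow> real) \<Rightarrow> (real \<Rightarrow> real) \<Rightarrow> real \<Rightarrow> ennreal" where
  "energy f y y' t = (\<integral>\<^sup>+\<tau>\<in>{t - 1..t}. ennreal ((y' \<tau> + f (y \<tau>))\<^sup>2) \<partial>lebesgue)"

text \<open>The interval integral is oriented, as required for negative arguments.\<close>

definition potential :: "(real \<Rightarrow> real) \<Rightarrow> real \<Rightarrow> real" where
  "potential f x = (LBINT z=0..x. f z)"

end

theory Submission
  imports Defs
begin

text \<open>
  Put \<open>w = y' + f(y)\<close>.  The equation says \<open>w(t) = -c (y'(t-1) + c g(y(t-1)))\<close>, so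
  \<open>w(t)\<^sup>2 - w(t-1)\<^sup>2\<close> equals
  \<open>-2 (f(y) - c g(y)) y' - (f(y)\<^sup>2 - g(y)\<^sup>2)\<close> taken at \<open>t-1\<close>.  The first term is the
  derivative of \<open>-2 \<Phi>(y)\<close> for \<open>\<Phi>(x) = \<integral>\<^sub>0\<^sup>x (f - c g)\<close>, which dominates \<open>(1-\<gamma>) F(x) \<ge> 0\<close>, and the
  second is at most \<open>-(1-\<gamma>\<^sup>2) f(y)\<^sup>2\<close>.  Integrating shows that
  \<open>E(t) + 2 \<Phi>(y(t-1)) + (1-\<gamma>\<^sup>2) \<integral> f(y)\<^sup>2\<close> over \<open>(-1,t-1)\<close> does not exceed its value at \<open>t = 0\<close>.
  Since \<open>g\<close> is only Borel measurable, \<open>\<Phi>\<close> is merely Lipschitz, and its chain rule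
  along \<open>y\<close> is obtained from the \<open>C\<^sup>1\<close> case by a monotone class argument.
  Finally \<open>y'\<close> is uniformly square integrable on unit intervals, so \<open>y\<close> is uniformly
  continuous, and square integrability of \<open>f(y)\<close> forces \<open>y\<close> to tend to \<open>0\<close>.
\<close>

section \<open>Smooth cut-off functions\<close>

text \<open>
  This class of explicit expressions is closed under differentiation, so its members are
  infinitely differentiable.
\<close>

inductive smooth_expr :: "(real \<Rightarrow> real) \<Rightarrow> bool" where
  flat: "smooth_expr (\<lambda>x. if x > 0 then inverse x ^ k * exp (- inverse x) else 0)"
| const: "smooth_expr (\<lambda>_. a)"
| add: "smooth_expr u \<Longrightarrow> smooth_expr v \<Longrightarrow> smooth_expr (\<lambda>x. u x + v x)"
| mult: "smooth_expr u \<Longrightarrow> smooth_expr v \<Longrightarrow> smooth_expr (\<lambda>x. u x * v x)"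
| inverse: "smooth_expr u \<Longrightarrow> (\<And>x. u x \<noteq> 0) \<Longrightarrow> smooth_expr (\<lambda>x. inverse (u x))"
| affine: "smooth_expr u \<Longrightarrow> smooth_expr (\<lambda>x. u (a * x + b))"

text \<open>The only delicate point is \<open>0\<close>. There the right-hand difference quotient is
  \<open>inverse y ^ (k + 1) * exp (- inverse y)\<close>, which tends to \<open>0\<close> because
  the exponential beats every power. The derivative is written as a combination of the same
  functions with exponents \<open>k + 2\<close> and \<open>k + 1\<close>, so that differentiation
  stays inside \<open>smooth_expr\<close>.\<close>

lemma flat_has_derivative:
  "((\<lambda>x::real. if x > 0 then inverse x ^ k * exp (- inverse x) else 0) has_real_derivative
     (if x > 0 then inverse x ^ (k + 2) * exp (- inverse x) else 0) +
     (- real k) * (if x > 0 then inverse x ^ (k + 1) * exp (- inverse x) else 0)) (at x)"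
proof -
  let ?h = "\<lambda>x::real. if x > 0 then inverse x ^ k * exp (- inverse x) else 0"
  consider "x > 0" | "x < 0" | "x = 0" by linarith
  then show ?thesis
  proof cases
    case 1
    have d: "(inverse has_real_derivative - (inverse x ^ 2)) (at x)"
      using DERIV_inverse[of x UNIV] 1 by (simp add: numeral_2_eq_2)
    have "((\<lambda>x. inverse x ^ k * exp (- inverse x)) has_real_derivative
        (real k * (- (inverse x ^ 2) * inverse x ^ (k - Suc 0))) * exp (- inverse x)
        + (exp (- inverse x) * - (- (inverse x ^ 2))) * inverse x ^ k) (at x)"
      by (intro DERIV_mult DERIV_power DERIV_fun_exp DERIV_minus d)
    moreover have "(real k * (- (inverse x ^ 2) * inverse x ^ (k - Suc 0))) * exp (- inverse x)
        + (exp (- inverse x) * - (- (inverse x ^ 2))) * inverse x ^ k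
        = inverse x ^ (k + 2) * exp (- inverse x) + (- real k) * (inverse x ^ (k + 1) * exp (- inverse x))"
      \<comment> \<open>The power rule produces the truncated exponent \<open>k - Suc 0\<close>; for
        \<open>k = 0\<close> the factor \<open>real k\<close> removes that term.\<close>
      by (cases k) (simp_all add: power2_eq_square algebra_simps)
    ultimately have "((\<lambda>x. inverse x ^ k * exp (- inverse x)) has_real_derivative
        inverse x ^ (k + 2) * exp (- inverse x) + (- real k) * (inverse x ^ (k + 1) * exp (- inverse x))) (at x)"
      by (simp only:)
    then have "((\<lambda>x. inverse x ^ k * exp (- inverse x)) has_real_derivative
        (if x > 0 then inverse x ^ (k + 2) * exp (- inverse x) else 0) +
     (- real k) * (if x > 0 then inverse x ^ (k + 1) * exp (- inverse x) else 0)) (at x)"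
      using 1 by simp
    then show ?thesis
      by (rule has_field_derivative_transform_within_open[where S = "{0<..}"]) (use 1 in auto)
  next
    case 2
    have "((\<lambda>_. 0) has_real_derivative (if x > 0 then inverse x ^ (k + 2) * exp (- inverse x) else 0) +
     (- real k) * (if x > 0 then inverse x ^ (k + 1) * exp (- inverse x) else 0)) (at x)"
      using 2 by simp
    then show ?thesis
      by (rule has_field_derivative_transform_within_open[where S = "{..<0}"]) (use 2 in auto)
  next
    case 3
    have "((\<lambda>y. inverse y ^ (k + 1) * exp (- inverse y)) \<longlongrightarrow> (0::real)) (at_right 0)"
      using filterlim_compose[OF tendsto_power_div_exp_0[of "k+1"] filterlim_inverse_at_top_right]
      by (simp add: exp_minus divide_inverse)
    then have "((\<lambda>y. ?h y / y) \<longlongrightarrow> 0) (at_right 0)"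
      by (rule Lim_transform_eventually)
        (auto simp: eventually_at_right_field field_simps intro!: exI[of _ 1])
    moreover have "((\<lambda>y. ?h y / y) \<longlongrightarrow> 0) (at_left 0)"
      by (rule tendsto_eventually) (auto simp: eventually_at_left_field intro!: exI[of _ "-1"])
    ultimately have "((\<lambda>y. ?h y / y) \<longlongrightarrow> 0) (at 0)"
      using filterlim_at_split by blast
    then show ?thesis
      using 3 by (simp add: has_field_derivative_iff)
  qed
qed

lemma smooth_expr_derivative:
  assumes "smooth_expr u"
  shows "\<exists>u'. smooth_expr u' \<and> (\<forall>x. (u has_real_derivative u' x) (at x))"
  using assms
proof induction
  case (flat k)
  show ?case
    by (intro exI conjI allI, rule smooth_expr.add[OF smooth_expr.flat smooth_expr.mult[OF smooth_expr.const smooth_expr.flat]])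
      (rule flat_has_derivative)
next
  case (const a)
  show ?case by (rule exI[of _ "\<lambda>_. 0"]) (auto intro: smooth_expr.const)
next
  case (add u v)
  then obtain u' v' where "smooth_expr u'" "smooth_expr v'" "\<forall>x. (u has_real_derivative u' x) (at x)"
    "\<forall>x. (v has_real_derivative v' x) (at x)" by blast
  then have "smooth_expr (\<lambda>x. u' x + v' x)"
    by (simp only: smooth_expr.add)
  moreover have "\<forall>x. ((\<lambda>x. u x + v x) has_real_derivative u' x + v' x) (at x)"
    using \<open>\<forall>x. (u has_real_derivative u' x) (at x)\<close> \<open>\<forall>x. (v has_real_derivative v' x) (at x)\<close>
    by (intro allI DERIV_add) (simp_all only: simp_thms)
  ultimately show ?case by blast
next
  case (mult u v)
  then obtain u' v' where "smooth_expr u'" "smooth_expr v'" "\<forall>x. (u has_real_derivative u' x) (at x)"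
    "\<forall>x. (v has_real_derivative v' x) (at x)" by blast
  with mult have "smooth_expr (\<lambda>x. u' x * v x + v' x * u x)"
    by (simp only: smooth_expr.add smooth_expr.mult)
  moreover have "\<forall>x. ((\<lambda>x. u x * v x) has_real_derivative u' x * v x + v' x * u x) (at x)"
    using \<open>\<forall>x. (u has_real_derivative u' x) (at x)\<close> \<open>\<forall>x. (v has_real_derivative v' x) (at x)\<close>
    by (intro allI DERIV_mult) (simp_all only: simp_thms)
  ultimately show ?case by blast
next
  case (inverse u)
  then obtain u' where "smooth_expr u'" "\<forall>x. (u has_real_derivative u' x) (at x)" by blast
  moreover have "smooth_expr (\<lambda>x. -1 * (inverse (u x) * u' x * inverse (u x)))"
    using inverse \<open>smooth_expr u'\<close> by (intro smooth_expr.mult smooth_expr.inverse smooth_expr.const)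
  moreover have "((\<lambda>x. inverse (u x)) has_real_derivative -1 * (inverse (u x) * u' x * inverse (u x))) (at x)" for x
    using DERIV_inverse'[of u "u' x" x UNIV] inverse calculation by simp
  ultimately show ?case by blast
next
  case (affine u a b)
  then obtain u' where "smooth_expr u'" "\<forall>x. (u has_real_derivative u' x) (at x)" by blast
  then have "((\<lambda>x. u (a * x + b)) has_real_derivative a * u' (a * x + b)) (at x)" for x
  proof -
    have "((\<lambda>x. a * x + b) has_real_derivative a) (at x)"
      by (auto intro!: derivative_eq_intros)
    from DERIV_chain2[OF _ this, of u "u' (a * x + b)"] \<open>\<forall>x. (u has_real_derivative u' x) (at x)\<close>
    show ?thesis by (simp add: mult.commute)
  qed
  moreover have "smooth_expr (\<lambda>x. a * u' (a * x + b))"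
    by (rule smooth_expr.mult[OF smooth_expr.const smooth_expr.affine[OF \<open>smooth_expr u'\<close>]])
  ultimately show ?case by blast
qed

lemma smooth_expr_deriv:
  assumes "smooth_expr u"
  shows "smooth_expr (deriv u)" "(u has_real_derivative deriv u x) (at x)"
proof -
  obtain u' where u': "smooth_expr u'" "\<And>x. (u has_real_derivative u' x) (at x)"
    using smooth_expr_derivative[OF assms] by blast
  then have "deriv u = u'" by (auto simp: DERIV_imp_deriv)
  with u' show "smooth_expr (deriv u)" "(u has_real_derivative deriv u x) (at x)" by auto
qed

lemma smooth_expr_continuous: "smooth_expr u \<Longrightarrow> continuous_on A u"
  by (rule DERIV_continuous_on[OF has_field_derivative_at_within[OF smooth_expr_deriv(2)]])

lemma smooth_expr_differentiable:
  assumes "smooth_expr u"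
  shows "(deriv ^^ n) u differentiable_on UNIV"
proof -
  have "smooth_expr ((deriv ^^ n) u)"
  proof (induction n)
    case (Suc n)
    then show ?case using smooth_expr_deriv(1) by simp
  qed (simp add: assms)
  then show ?thesis
    using smooth_expr_deriv(2)[of "(deriv ^^ n) u"]
    by (intro differentiable_at_imp_differentiable_on field_differentiable_imp_differentiable) (auto simp: field_differentiable_def)
qed

text \<open>The step is the quotient h(x) / (h(x) + h(1 - x)) with the flat function h(x) =
  exp(-1/x) for x > 0. The denominator is positive because x or 1 - x is.\<close>

lemma smooth_step_exists:
  obtains H :: "real \<Rightarrow> real" where "smooth_expr H" "\<And>x. x \<le> 0 \<Longrightarrow> H x = 0"
    "\<And>x. x \<ge> 1 \<Longrightarrow> H x = 1" "\<And>x. 0 \<le> H x" "\<And>x. H x \<le> 1"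
proof -
  obtain h :: "real \<Rightarrow> real" where h: "smooth_expr h" "\<And>x. x \<le> 0 \<Longrightarrow> h x = 0" "\<And>x. x > 0 \<Longrightarrow> h x > 0"
  proof (rule that[OF smooth_expr.flat[of 0]])
  qed simp_all
  have h0: "0 \<le> h x" for x
    using h(2)[of x] h(3)[of x] by (cases "x \<le> 0") simp_all
  \<comment> \<open>The argument 1 - x is spelled as an affine expression so that the rule
    \<open>affine\<close> matches.\<close>
  define s where "s = (\<lambda>x. h x + h ((-1) * x + 1))"
  have pos: "s x > 0" for x
    using h0[of x] h0[of "1 - x"] h(3)[of x] h(3)[of "1 - x"]
    by (cases "x > 0") (simp_all add: s_def add_pos_nonneg add_nonneg_pos)
  have le: "h x \<le> s x" for x
    using h0 by (simp add: s_def)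
  have "smooth_expr s"
    unfolding s_def by (rule smooth_expr.add[OF h(1) smooth_expr.affine[OF h(1)]])
  then have "smooth_expr (\<lambda>x. inverse (s x))"
    by (rule smooth_expr.inverse) (rule less_imp_neq[OF pos, symmetric])
  then have "smooth_expr (\<lambda>x. h x * inverse (s x))"
    by (rule smooth_expr.mult[OF h(1)])
  then show ?thesis
  proof (rule that)
    show "h x * inverse (s x) = 0" if "x \<le> 0" for x
      using h(2)[OF that] by simp
    show "h x * inverse (s x) = 1" if "x \<ge> 1" for x
      using h(2)[of "1 - x"] pos[of x] that by (simp add: s_def)
    show "0 \<le> h x * inverse (s x)" for x
      using h0[of x] pos[of x] by simp
    show "h x * inverse (s x) \<le> 1" for x
      using le[of x] pos[of x] by (simp add: field_simps)
  qed
qed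

text \<open>The bump changes from 0 to 1 on \<open>{a..a + e}\<close> and back on
  \<open>{b..b + e}\<close> when these do not overlap. As e tends to 0 it tends pointwise to the
  indicator of \<open>{a<..b}\<close>, which is what the passage from test functions to integrals
  over intervals needs.\<close>

lemma test_function_smooth_bump:
  assumes H: "smooth_expr H" "\<And>x. x \<le> 0 \<Longrightarrow> H x = 0" "\<And>x. x \<ge> 1 \<Longrightarrow> H x = 1"
    and "a \<le> b" "e > 0" "{a..b + e} \<subseteq> I"
  shows "test_function_on I (\<lambda>x. H ((x - a) / e) - H ((x - b) / e))"
proof -
  have *: "smooth_expr (\<lambda>x. H ((1 / e) * x + (- a / e)) + (-1) * H ((1 / e) * x + (- b / e)))"
    by (rule smooth_expr.add[OF smooth_expr.affine[OF H(1)]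
          smooth_expr.mult[OF smooth_expr.const smooth_expr.affine[OF H(1)]]])
  have smooth: "smooth_expr (\<lambda>x. H ((x - a) / e) - H ((x - b) / e))"
    using * by (simp add: diff_divide_distrib)
  have "H ((x - a) / e) - H ((x - b) / e) = 0" if "x \<notin> {a..b + e}" for x
  proof (cases "x < a")
    case True
    then show ?thesis using assms by (simp add: divide_nonpos_pos)
  next
    case False
    then have "(x - a) / e \<ge> 1" "(x - b) / e \<ge> 1" using that assms by auto
    then show ?thesis using H(3) by simp
  qed
  then have "{x. H ((x - a) / e) - H ((x - b) / e) \<noteq> 0} \<subseteq> {a..b + e}" by blast
  then have "closure {x. H ((x - a) / e) - H ((x - b) / e) \<noteq> 0} \<subseteq> {a..b + e}"
    and "bounded {x. H ((x - a) / e) - H ((x - b) / e) \<noteq> 0}"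
    by (simp_all only: closure_minimal closed_atLeastAtMost bounded_subset[OF bounded_closed_interval])
  then show ?thesis
    unfolding test_function_on_def using smooth_expr_differentiable[OF smooth] assms(6)
    by (simp only: compact_closure) blast
qed

section \<open>Weak derivatives and integrals\<close>

lemma smooth_step_deriv_outside:
  fixes H :: "real \<Rightarrow> real"
  assumes "\<And>x. x \<le> 0 \<Longrightarrow> H x = 0" "\<And>x. x \<ge> 1 \<Longrightarrow> H x = 1" "x < 0 \<or> x > 1"
  shows "deriv H x = 0"
  using assms(3)
proof
  assume "x < 0"
  have "(H has_real_derivative 0) (at x)"
    by (rule has_field_derivative_transform_within_open[of "\<lambda>_. 0" 0 x "{..<0}"])
      (use \<open>x < 0\<close> assms(1) in auto)
  then show ?thesis by (rule DERIV_imp_deriv)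
next
  assume "x > 1"
  have "(H has_real_derivative 0) (at x)"
    by (rule has_field_derivative_transform_within_open[of "\<lambda>_. 1" 0 x "{1<..}"])
      (use \<open>x > 1\<close> assms(2) in auto)
  then show ?thesis by (rule DERIV_imp_deriv)
qed

text \<open>The kernel lives on \<open>{p..p + e n}\<close> and has total mass H(1) - H(0) = 1, so
  it concentrates at p from the right. Since H is not assumed monotone, the error is controlled by
  the sup norm of the kernel times the length of its support.\<close>

lemma approximate_identity:
  fixes H u :: "real \<Rightarrow> real" and e :: "nat \<Rightarrow> real"
  assumes H: "smooth_expr H" "\<And>x. x \<le> 0 \<Longrightarrow> H x = 0" "\<And>x. x \<ge> 1 \<Longrightarrow> H x = 1"
    and u: "continuous_on {A..B} u" and p: "A \<le> p"
    and e: "\<And>n. 0 < e n" "\<And>n. p + e n \<le> B" "e \<longlonglongrightarrow> 0"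
  shows "(\<lambda>n. integral {A..B} (\<lambda>x. u x * (deriv H ((x - p) / e n) / e n))) \<longlonglongrightarrow> u p"
proof (rule LIMSEQ_I)
  fix r :: real assume "r > 0"
  have contH: "continuous_on S (deriv H)" for S
    by (rule smooth_expr_continuous[OF smooth_expr_deriv(1)[OF H(1)]])
  have "bounded (deriv H ` {0..1})"
    by (rule compact_imp_bounded[OF compact_continuous_image[OF contH compact_Icc]])
  then obtain M where M: "M > 0" "\<And>x. x \<in> {0..1} \<Longrightarrow> \<bar>deriv H x\<bar> \<le> M"
    by (auto simp: bounded_pos)
  have pK: "p \<in> {A..B}" using p e(1)[of 0] e(2)[of 0] by simp
  \<comment> \<open>The kernel is at most \<open>M / e n\<close> on an interval of length
    \<open>e n\<close>, so an oscillation of u below \<open>r / (2 * M)\<close> costs at most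
    r/2.\<close>
  have "r / (2 * M) > 0" using M(1) \<open>r > 0\<close> by simp
  then obtain d where d: "d > 0" "\<And>x. x \<in> {A..B} \<Longrightarrow> dist x p < d \<Longrightarrow> dist (u x) (u p) < r / (2 * M)"
    using u pK unfolding continuous_on_iff by metis
  obtain N where N: "\<And>n. n \<ge> N \<Longrightarrow> \<bar>e n\<bar> < d"
    using LIMSEQ_D[OF e(3) d(1)] by auto
  show "\<exists>no. \<forall>n\<ge>no. norm (integral {A..B} (\<lambda>x. u x * (deriv H ((x - p) / e n) / e n)) - u p) < r"
  proof (intro exI[of _ N] allI impI)
    fix n assume "n \<ge> N"
    let ?S = "{p..p + e n}"
    let ?k = "\<lambda>x. deriv H ((x - p) / e n) / e n"
    have en: "0 < e n" "e n < d" using e(1) N[OF \<open>n \<ge> N\<close>] by auto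
    have S: "?S \<subseteq> {A..B}" using p e(2)[of n] by auto
    have contk: "continuous_on ?S ?k"
      using en by (intro continuous_intros continuous_on_compose2[OF contH[of UNIV]]) auto
    have contu: "continuous_on ?S u" using u S continuous_on_subset by blast
    have "((\<lambda>x. H ((x - p) / e n)) has_real_derivative ?k x) (at x within ?S)" for x
    proof -
      have "((\<lambda>x. (x - p) / e n) has_real_derivative 1 / e n) (at x within ?S)"
        using en by (auto intro!: derivative_eq_intros)
      from DERIV_chain2[OF smooth_expr_deriv(2)[OF H(1)] this] show ?thesis by simp
    qed
    then have "(?k has_integral H ((p + e n - p) / e n) - H ((p - p) / e n)) ?S"
      using en by (intro fundamental_theorem_of_calculus)
        (auto simp flip: has_real_derivative_iff_has_vector_derivative)
    then have k1: "(?k has_integral 1) ?S" using H(2)[of 0] H(3)[of 1] en by simp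
    have "((\<lambda>x. u x * ?k x) has_integral integral ?S (\<lambda>x. u x * ?k x)) ?S"
      by (intro integrable_integral integrable_continuous_real continuous_intros contk contu)
    moreover have "?k x = 0" if "x \<notin> ?S" for x
    proof -
      have "(x - p) / e n < 0 \<or> (x - p) / e n > 1"
        using that en by (auto simp: field_simps)
      then show ?thesis using smooth_step_deriv_outside[OF H(2,3)] by simp
    qed
    then have "u x * ?k x = 0" if "x \<notin> ?S" for x using that by simp
    ultimately have "((\<lambda>x. u x * ?k x) has_integral integral ?S (\<lambda>x. u x * ?k x)) {A..B}"
      by (rule has_integral_on_superset) (use S in auto)
    then have "integral {A..B} (\<lambda>x. u x * ?k x) - u p = integral ?S (\<lambda>x. u x * ?k x) - u p"
      by (simp only: integral_unique)
    also have "\<dots> = integral ?S (\<lambda>x. u x * ?k x) - integral ?S (\<lambda>x. u p * ?k x)"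
      using integral_unique[OF has_integral_mult_right[OF k1, of "u p"]] by simp
    also have "\<dots> = integral ?S (\<lambda>x. u x * ?k x - u p * ?k x)"
      by (intro integral_diff[symmetric] integrable_continuous_real continuous_intros contk contu)
    also have "norm \<dots> \<le> (r / (2 * M) * (M / e n)) * (p + e n - p)"
    proof (rule integral_bound)
      fix x assume x: "x \<in> ?S"
      then have "dist (u x) (u p) < r / (2 * M)"
        using d(2)[of x] S en by (auto simp: dist_real_def)
      moreover have "\<bar>?k x\<bar> \<le> M / e n"
        using M(2)[of "(x - p) / e n"] x en by (auto simp: field_simps abs_divide)
      ultimately have "\<bar>u x - u p\<bar> * \<bar>?k x\<bar> \<le> r / (2 * M) * (M / e n)"
        by (intro mult_mono) (use M(1) \<open>r > 0\<close> in \<open>auto simp: dist_real_def\<close>)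
      then show "norm (u x * ?k x - u p * ?k x) \<le> r / (2 * M) * (M / e n)"
        by (simp add: abs_mult left_diff_distrib[symmetric] del: times_divide_eq_right)
    qed (use en in simp, intro continuous_intros contk contu)
    also have "\<dots> < r" using M(1) en \<open>r > 0\<close> by (simp add: field_simps)
    finally show "norm (integral {A..B} (\<lambda>x. u x * ?k x) - u p) < r" .
  qed
qed

text \<open>Test with bumps tending to the indicator of \<open>{a<..b}\<close>. Their derivatives
  approximate a unit mass at a minus one at b, so one side of the weak identity tends to u(a) -
  u(b); by dominated convergence the other tends to minus the integral of v.\<close>

lemma weak_derivative_integral:
  assumes w: "weak_derivative_on I u v" and I: "open I" and u: "continuous_on I u"
    and ab: "a \<le> b" "{a..b} \<subseteq> I"
  shows "(v has_integral u b - u a) {a..b}"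
proof -
  obtain H :: "real \<Rightarrow> real" where H: "smooth_expr H" "\<And>x. x \<le> 0 \<Longrightarrow> H x = 0"
    "\<And>x. x \<ge> 1 \<Longrightarrow> H x = 1" "\<And>x. 0 \<le> H x" "\<And>x. H x \<le> 1"
    using smooth_step_exists by blast
  obtain d where d: "d > 0" "cball b d \<subseteq> I"
    using I ab open_contains_cball by (metis atLeastAtMost_iff order_refl subsetD)
  \<comment> \<open>All bumps are supported in the compact set \<open>{a..B}\<close> inside I, where
    v is integrable; this provides the dominating function.\<close>
  define B where "B = b + d"
  have KI: "{a..B} \<subseteq> I"
  proof
    fix x assume "x \<in> {a..B}"
    then have "x \<in> {a..b} \<or> x \<in> cball b d" by (auto simp: B_def dist_real_def)
    then show "x \<in> I" using ab d by blast
  qed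
  define e where "e = (\<lambda>n. d / real (Suc n))"
  have e: "0 < e n" "e n \<le> d" for n using d(1) by (auto simp: e_def field_simps)
  have e0: "e \<longlonglongrightarrow> 0"
    unfolding e_def by (rule LIMSEQ_Suc[OF lim_const_over_n])
  have aB: "a + e n \<le> B" "b + e n \<le> B" for n using e(2)[of n] ab by (auto simp: B_def)
  define \<phi> where "\<phi> = (\<lambda>n x. H ((x - a) / e n) - H ((x - b) / e n))"
  have test: "test_function_on I (\<phi> n)" for n
    unfolding \<phi>_def using aB(2)[of n] KI
    by (intro test_function_smooth_bump H(1-3) ab e) auto
  have d\<phi>: "deriv (\<phi> n) x = deriv H ((x - a) / e n) / e n - deriv H ((x - b) / e n) / e n" for n x
  proof -
    have "((\<lambda>x. H ((x - p) / e n)) has_real_derivative deriv H ((x - p) / e n) / e n) (at x)" for p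
    proof -
      have "((\<lambda>x. (x - p) / e n) has_real_derivative 1 / e n) (at x)"
        using e(1)[of n] by (auto intro!: derivative_eq_intros)
      from DERIV_chain2[OF smooth_expr_deriv(2)[OF H(1)] this] show ?thesis by simp
    qed
    then show ?thesis unfolding \<phi>_def by (intro DERIV_imp_deriv DERIV_diff)
  qed
  have out: "\<phi> n x = 0" "deriv (\<phi> n) x = 0" if outx: "x \<notin> {a..B}" for n x
  proof -
    consider "x < a" | "x > a + e n" "x > b + e n"
      using outx aB[of n] by (cases "x < a") auto
    then have "\<phi> n x = 0 \<and> deriv (\<phi> n) x = 0"
    proof cases
      case 1
      then have "(x - a) / e n < 0" "(x - b) / e n < 0"
        using e(1)[of n] ab by (auto simp: divide_neg_pos)
      then show ?thesis unfolding d\<phi> using H(2) smooth_step_deriv_outside[OF H(2,3)]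
        by (simp add: \<phi>_def)
    next
      case 2
      then have "(x - a) / e n > 1" "(x - b) / e n > 1"
        using e(1)[of n] by auto
      then show ?thesis unfolding d\<phi> using H(3) smooth_step_deriv_outside[OF H(2,3)]
        by (simp add: \<phi>_def)
    qed
    then show "\<phi> n x = 0" "deriv (\<phi> n) x = 0" by auto
  qed
  have contu: "continuous_on {a..B} u" using u KI continuous_on_subset by blast
  have contdH: "continuous_on S (deriv H)" for S
    by (rule smooth_expr_continuous[OF smooth_expr_deriv(1)[OF H(1)]])
  have contk: "continuous_on {a..B} (\<lambda>x. deriv H ((x - p) / e n) / e n)" for p n
    using e(1)[of n] by (intro continuous_intros continuous_on_compose2[OF contdH[of UNIV]]) auto
  have L: "(LINT x:I|lebesgue. u x * deriv (\<phi> n) x) =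
      integral {a..B} (\<lambda>x. u x * (deriv H ((x - a) / e n) / e n)) -
      integral {a..B} (\<lambda>x. u x * (deriv H ((x - b) / e n) / e n))" for n
  proof -
    have "(LINT x:I|lebesgue. u x * deriv (\<phi> n) x) = (LINT x:{a..B}|lebesgue. u x * deriv (\<phi> n) x)"
      unfolding set_lebesgue_integral_def
      by (rule Bochner_Integration.integral_cong) (use KI out in \<open>auto simp: indicator_def\<close>)
    also have "\<dots> = integral {a..B} (\<lambda>x. u x * deriv (\<phi> n) x)"
      unfolding d\<phi>
      by (intro set_lebesgue_integral_eq_integral absolutely_integrable_continuous_real
          continuous_intros contu contk)
    also have "\<dots> = integral {a..B} (\<lambda>x. u x * (deriv H ((x - a) / e n) / e n) - u x * (deriv H ((x - b) / e n) / e n))"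
      by (simp only: d\<phi> right_diff_distrib)
    also have "\<dots> = integral {a..B} (\<lambda>x. u x * (deriv H ((x - a) / e n) / e n)) -
      integral {a..B} (\<lambda>x. u x * (deriv H ((x - b) / e n) / e n))"
      by (intro Henstock_Kurzweil_Integration.integral_diff integrable_continuous_real continuous_intros contu contk)
    finally show ?thesis .
  qed
  have "(\<lambda>n. LINT x:I|lebesgue. u x * deriv (\<phi> n) x) \<longlonglongrightarrow> u a - u b"
    unfolding L by (intro tendsto_diff approximate_identity H(1-3) contu e(1) aB e0 order_refl ab)
  moreover have "(LINT x:I|lebesgue. u x * deriv (\<phi> n) x) = - (LINT x:I|lebesgue. v x * \<phi> n x)" for n
    using w test unfolding weak_derivative_on_def by blast
  ultimately have 1: "(\<lambda>n. - (LINT x:I|lebesgue. v x * \<phi> n x)) \<longlonglongrightarrow> u a - u b" by simp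
  have vK: "v absolutely_integrable_on {a..B}"
    using w KI unfolding weak_derivative_on_def L1_loc_def by simp
  have R: "(LINT x:I|lebesgue. v x * \<phi> n x) = (LINT x|lebesgue. (indicator {a..B} x *\<^sub>R v x) * \<phi> n x)" for n
    unfolding set_lebesgue_integral_def
    by (rule Bochner_Integration.integral_cong) (use KI out in \<open>auto simp: indicator_def\<close>)
  have cont\<phi>: "continuous_on UNIV (\<phi> n)" for n
    unfolding \<phi>_def using e(1)[of n]
    by (intro continuous_intros continuous_on_compose2[OF smooth_expr_continuous[OF H(1), of UNIV]]) auto
  have "(\<lambda>n. LINT x|lebesgue. (indicator {a..B} x *\<^sub>R v x) * \<phi> n x) \<longlonglongrightarrow>
      (LINT x|lebesgue. indicator {a<..b} x *\<^sub>R v x)"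
  proof (rule integral_dominated_convergence[where w = "\<lambda>x. \<bar>indicator {a..B} x *\<^sub>R v x\<bar>"])
    have m: "(\<lambda>x. indicator {a..B} x *\<^sub>R v x) \<in> borel_measurable lebesgue"
      using vK unfolding set_integrable_def by simp
    have "\<phi> n \<in> borel_measurable lebesgue" for n
      by (rule measurable_completion) (simp add: borel_measurable_continuous_onI[OF cont\<phi>])
    then show "(\<lambda>x. (indicator {a..B} x *\<^sub>R v x) * \<phi> n x) \<in> borel_measurable lebesgue" for n
      using m by (intro borel_measurable_times)
    have "(\<lambda>x. indicator {a<..b} x *\<^sub>R (indicator {a..B} x *\<^sub>R v x)) \<in> borel_measurable lebesgue"
      by (rule borel_measurable_scaleR[OF borel_measurable_indicator m]) simp
    also have "(\<lambda>x. indicator {a<..b} x *\<^sub>R (indicator {a..B} x *\<^sub>R v x)) = (\<lambda>x. indicator {a<..b} x *\<^sub>R v x)"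
      using d(1) by (auto simp: indicator_def B_def)
    finally show "(\<lambda>x. indicator {a<..b} x *\<^sub>R v x) \<in> borel_measurable lebesgue" .
    show "integrable lebesgue (\<lambda>x. \<bar>indicator {a..B} x *\<^sub>R v x\<bar>)"
      using vK unfolding set_integrable_def by (rule integrable_abs)
    show "AE x in lebesgue. (\<lambda>n. (indicator {a..B} x *\<^sub>R v x) * \<phi> n x) \<longlonglongrightarrow> indicator {a<..b} x *\<^sub>R v x"
    proof (rule AE_I2)
      fix x
      \<comment> \<open>At \<open>x = p\<close> the step equals \<open>H 0 = 0\<close> for every n,
        which is why the limit is the half-open interval. The missing endpoint a is negligible and
        is restored at the end.\<close>
      have ev1: "\<forall>\<^sub>F n in sequentially. H ((x - p) / e n) = (if x > p then 1 else 0)" for p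
      proof (cases "x > p")
        case True
        have "\<forall>\<^sub>F n in sequentially. e n < x - p"
          using order_tendstoD(2)[OF e0, of "x - p"] True by simp
        then show ?thesis
        proof eventually_elim
          case (elim n)
          then have "(x - p) / e n \<ge> 1" using e(1)[of n] by simp
          then show ?case using H(3) True by simp
        qed
      next
        case False
        then have "(x - p) / e n \<le> 0" for n using e(1)[of n] by (simp add: divide_nonpos_pos)
        then show ?thesis using H(2) False by simp
      qed
      have "\<forall>\<^sub>F n in sequentially. (indicator {a..B} x *\<^sub>R v x) * \<phi> n x = indicator {a<..b} x *\<^sub>R v x"
        using ev1[of a] ev1[of b]
      proof eventually_elim
        case (elim n)
        then show ?case using ab d(1) by (auto simp: \<phi>_def indicator_def B_def)
      qed
      then show "(\<lambda>n. (indicator {a..B} x *\<^sub>R v x) * \<phi> n x) \<longlonglongrightarrow> indicator {a<..b} x *\<^sub>R v x"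
        by (rule tendsto_eventually)
    qed
    show "AE x in lebesgue. norm ((indicator {a..B} x *\<^sub>R v x) * \<phi> n x) \<le> \<bar>indicator {a..B} x *\<^sub>R v x\<bar>" for n
    proof (rule AE_I2)
      fix x
      have "\<bar>\<phi> n x\<bar> \<le> 1"
        using H(4,5)[of "(x - a) / e n"] H(4,5)[of "(x - b) / e n"] by (simp add: \<phi>_def)
      then show "norm ((indicator {a..B} x *\<^sub>R v x) * \<phi> n x) \<le> \<bar>indicator {a..B} x *\<^sub>R v x\<bar>"
        by (simp add: abs_mult mult_left_le)
    qed
  qed
  then have "(\<lambda>n. - (LINT x:I|lebesgue. v x * \<phi> n x)) \<longlonglongrightarrow> - (LINT x:{a<..b}|lebesgue. v x)"
    unfolding R unfolding set_lebesgue_integral_def by (rule tendsto_minus)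
  with 1 have "(LINT x:{a<..b}|lebesgue. v x) = u b - u a"
    using LIMSEQ_unique by fastforce
  moreover have "v absolutely_integrable_on {a<..b}"
    by (rule set_integrable_subset[OF vK]) (use d(1) in \<open>auto simp: B_def\<close>)
  ultimately have "(v has_integral u b - u a) {a<..b}"
    by (metis has_integral_set_lebesgue)
  then show ?thesis
    by (subst has_integral_spike_set_eq[where T = "{a<..b}"])
      (auto intro: negligible_subset[OF negligible_sing[of a]])
qed

text \<open>By Lebesgue differentiation, almost every value of h is a limit of averages over
  \<open>{x..x + t}\<close>, and these averages vanish. Countably many intervals with rational
  endpoints cover I, so the exceptional sets can be united.\<close>

lemma integral_zero_imp_AE:
  fixes h :: "real \<Rightarrow> real"
  assumes I: "open I"
    and h: "\<And>a b. a \<le> b \<Longrightarrow> {a..b} \<subseteq> I \<Longrightarrow> (h has_integral 0) {a..b}"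
  shows "AE x in lebesgue. x \<in> I \<longrightarrow> h x = 0"
proof -
  have loc: "AE x in lebesgue. x \<in> {a<..<b} \<longrightarrow> h x = 0" if ab: "{a..b} \<subseteq> I" for a b
  proof (cases "a < b")
    case True
    \<comment> \<open>The differentiation theorem is applied to a function integrable on every
      bounded interval, hence the cut-off outside \<open>{a..b}\<close>.\<close>
    define k where "k = (\<lambda>x. if x \<in> {a..b} then h x else 0)"
    have "k integrable_on cbox c d" for c d
    proof -
      have "h integrable_on {a..b} \<inter> {c..d}"
        using integrable_on_subinterval[of h "{a..b}" "max a c" "min b d"] h[OF _ ab] True
        by (auto simp: Int_atLeastAtMost intro: has_integral_integrable)
      then show ?thesis
        unfolding k_def using integrable_restrict_Int[of "{a..b}" h "{c..d}"] by simp
    qed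
    then obtain N where N: "negligible N" "\<And>x e. \<lbrakk>x \<notin> N; 0 < e\<rbrakk> \<Longrightarrow>
        \<exists>d>0. \<forall>t. 0 < t \<and> t < d \<longrightarrow>
          norm (integral (cbox x (x + t *\<^sub>R One)) k /\<^sub>R t ^ DIM(real) - k x) < e"
      by (rule integrable_ccontinuous_explicit) (rule that)
    have zero: "h x = 0" if x: "x \<in> {a<..<b}" "x \<notin> N" for x
    proof (rule ccontr)
      assume "h x \<noteq> 0"
      then have "0 < \<bar>h x\<bar>" by simp
      from N(2)[OF x(2) this] obtain d where d: "d > 0" "\<And>t. 0 < t \<Longrightarrow> t < d \<Longrightarrow>
          norm (integral (cbox x (x + t *\<^sub>R One)) k /\<^sub>R t ^ DIM(real) - k x) < \<bar>h x\<bar>"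
        by metis
      \<comment> \<open>This window is short enough for the estimate and stays inside
        \<open>{a..b}\<close>, where k agrees with h.\<close>
      define t where "t = min (d / 2) (b - x)"
      have t: "0 < t" "t < d" "x + t \<le> b" using d(1) x(1) by (auto simp: t_def)
      have sub: "{x..x + t} \<subseteq> {a..b}" using x t by auto
      then have "integral {x..x + t} k = integral {x..x + t} h"
        by (intro Henstock_Kurzweil_Integration.integral_cong) (auto simp: k_def)
      also have "\<dots> = 0"
        by (rule integral_unique[OF h]) (use sub ab t(1) in auto)
      finally have "norm (k x) < \<bar>h x\<bar>" using d(2)[OF t(1,2)] by simp
      then show False using x(1) by (simp add: k_def)
    qed
    have "N \<in> null_sets lebesgue" using N(1) by (simp add: negligible_iff_null_sets)
    then show ?thesis
      by (rule AE_I') (use zero in auto)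
  qed auto
  have "AE x in lebesgue. \<forall>p q :: rat. {real_of_rat p..real_of_rat q} \<subseteq> I \<longrightarrow>
      x \<in> {real_of_rat p<..<real_of_rat q} \<longrightarrow> h x = 0"
    unfolding AE_all_countable using loc by (intro allI) (case_tac "{real_of_rat p..real_of_rat q} \<subseteq> I", auto)
  then show ?thesis
  proof eventually_elim
    case (elim x)
    show ?case
    proof
      assume "x \<in> I"
      then obtain e where e: "e > 0" "ball x e \<subseteq> I" using I openE by blast
      obtain p where p: "x - e < real_of_rat p" "real_of_rat p < x"
        using of_rat_dense[of "x - e" x] e(1) by auto
      obtain q where q: "x < real_of_rat q" "real_of_rat q < x + e"
        using of_rat_dense[of x "x + e"] e(1) by auto
      have "{real_of_rat p..real_of_rat q} \<subseteq> ball x e"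
        using p q by (auto simp: dist_real_def)
      with elim e p q show "h x = 0" by fastforce
    qed
  qed
qed

text \<open>Both derivatives integrate to the same increments over compact intervals, so their
  difference integrates to zero there. Two nested open sets are allowed in order to compare the
  derivative of the initial datum on (-1,0) with that of the solution on the whole
  half-line.\<close>

lemma weak_derivative_unique:
  assumes "weak_derivative_on I u v" "weak_derivative_on J u' v'" "open I" "open J" "I \<subseteq> J"
    and "continuous_on J u'" and eq: "\<And>x. x \<in> I \<Longrightarrow> u x = u' x"
  shows "AE x in lebesgue. x \<in> I \<longrightarrow> v x = v' x"
proof -
  have "continuous_on I u"
    using continuous_on_subset[OF assms(6,5)] eq by (simp cong: continuous_on_cong)
  have "AE x in lebesgue. x \<in> I \<longrightarrow> v x - v' x = 0"
  proof (rule integral_zero_imp_AE[OF assms(3)])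
    fix a b :: real assume ab: "a \<le> b" "{a..b} \<subseteq> I"
    have "((\<lambda>x. v x - v' x) has_integral (u b - u a) - (u' b - u' a)) {a..b}"
      using ab(2) assms(5)
      by (intro has_integral_diff weak_derivative_integral[OF assms(1,3) \<open>continuous_on I u\<close> ab]
          weak_derivative_integral[OF assms(2,4,6) ab(1)]) simp
    then show "((\<lambda>x. v x - v' x) has_integral 0) {a..b}"
      using eq[of a] eq[of b] ab by (simp add: subset_eq)
  qed
  then show ?thesis by simp
qed

section \<open>The chain rule for Borel integrands\<close>

text \<open>A monotone class argument: the images under \<open>T1\<close> and \<open>T2\<close> of
  the signed measures with densities \<open>h1\<close> and \<open>h2\<close> agree on bounded
  continuous functions, hence on half-lines, on Borel sets by the pi-lambda theorem, and on bounded
  Borel functions. The predicate \<open>E\<close> collects the integrands for which equality holds;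
  it is closed under linear combinations and bounded pointwise limits.\<close>

lemma integral_eq_of_continuous_bounded:
  fixes h1 :: "'a \<Rightarrow> real" and h2 :: "'b \<Rightarrow> real" and T1 T2 :: "_ \<Rightarrow> real" and u :: "real \<Rightarrow> real"
  assumes h: "integrable M1 h1" "integrable M2 h2"
    and T: "T1 \<in> borel_measurable M1" "T2 \<in> borel_measurable M2"
    and eq: "\<And>\<psi> C. continuous_on UNIV \<psi> \<Longrightarrow> (\<And>z. \<bar>\<psi> z\<bar> \<le> C) \<Longrightarrow>
      (\<integral>x. \<psi> (T1 x) * h1 x \<partial>M1) = (\<integral>x. \<psi> (T2 x) * h2 x \<partial>M2)"
    and u: "u \<in> borel_measurable borel" "\<And>z. \<bar>u z\<bar> \<le> C"
  shows "(\<integral>x. u (T1 x) * h1 x \<partial>M1) = (\<integral>x. u (T2 x) * h2 x \<partial>M2)"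
proof -
  define E where "E = (\<lambda>u. (\<integral>x. u (T1 x) * h1 x \<partial>M1) = (\<integral>x. u (T2 x) * h2 x \<partial>M2))"
  have int: "integrable M (\<lambda>x. u (T x) * h x)"
    if "integrable M h" "T \<in> borel_measurable M" "u \<in> borel_measurable borel" "\<And>z. \<bar>u z\<bar> \<le> C"
    for M :: "'c measure" and h :: "'c \<Rightarrow> real" and T :: "'c \<Rightarrow> real" and u :: "real \<Rightarrow> real" and C
  proof (rule Bochner_Integration.integrable_bound)
    show "integrable M (\<lambda>x. C * h x)" using that by simp
    have "(\<lambda>x. u (T x)) \<in> borel_measurable M" using that by measurable
    then show "(\<lambda>x. u (T x) * h x) \<in> borel_measurable M"
      using that by (intro borel_measurable_times) auto
    have "C \<ge> 0" using that(4)[of 0] by linarith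
    with that show "AE x in M. norm (u (T x) * h x) \<le> norm (C * h x)"
      by (intro AE_I2) (simp add: abs_mult mult_right_mono)
  qed
  have lin: "E (\<lambda>z. c * u z + d * v z)"
    if "u \<in> borel_measurable borel" "\<And>z. \<bar>u z\<bar> \<le> C" "v \<in> borel_measurable borel" "\<And>z. \<bar>v z\<bar> \<le> D" "E u" "E v"
    for u v c d C D
  proof -
    have "(\<integral>x. (c * u (T x) + d * v (T x)) * h x \<partial>M) =
        c * (\<integral>x. u (T x) * h x \<partial>M) + d * (\<integral>x. v (T x) * h x \<partial>M)"
      if "integrable M h" "T \<in> borel_measurable M" for M :: "'c measure" and h T
    proof -
      have "(\<integral>x. (c * u (T x) + d * v (T x)) * h x \<partial>M) =
          (\<integral>x. c * (u (T x) * h x) + d * (v (T x) * h x) \<partial>M)"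
        by (simp add: algebra_simps)
      then show ?thesis
        using int[OF that \<open>u \<in> borel_measurable borel\<close> \<open>\<And>z. \<bar>u z\<bar> \<le> C\<close>]
          int[OF that \<open>v \<in> borel_measurable borel\<close> \<open>\<And>z. \<bar>v z\<bar> \<le> D\<close>] by simp
    qed
    from this[OF h(1) T(1)] this[OF h(2) T(2)] show ?thesis
      using that(5,6) by (simp add: E_def)
  qed
  have lim: "E u"
    if U: "\<And>n. U n \<in> borel_measurable borel" "\<And>n z. \<bar>U n z\<bar> \<le> C" "\<And>n. E (U n)"
      "\<And>z. (\<lambda>n. U n z) \<longlonglongrightarrow> u z"
    for U :: "nat \<Rightarrow> real \<Rightarrow> real" and u C
  proof -
    have u: "u \<in> borel_measurable borel"
      by (rule borel_measurable_LIMSEQ_metric[OF U(1)]) (rule U(4))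
    have "(\<lambda>n. \<integral>x. U n (T x) * h x \<partial>M) \<longlonglongrightarrow> (\<integral>x. u (T x) * h x \<partial>M)"
      if "integrable M h" "T \<in> borel_measurable M" for M :: "'c measure" and h T
    proof (rule integral_dominated_convergence[where w = "\<lambda>x. norm (C * h x)"])
      have "(\<lambda>x. u (T x)) \<in> borel_measurable M" "\<And>n. (\<lambda>x. U n (T x)) \<in> borel_measurable M"
        using u U(1) that(2) by measurable
      with that(1) show "(\<lambda>x. u (T x) * h x) \<in> borel_measurable M"
        "\<And>n. (\<lambda>x. U n (T x) * h x) \<in> borel_measurable M"
        by (auto intro!: borel_measurable_times)
      show "integrable M (\<lambda>x. norm (C * h x))"
        using that(1) by (intro integrable_norm) simp
      show "AE x in M. (\<lambda>n. U n (T x) * h x) \<longlonglongrightarrow> u (T x) * h x"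
        by (intro AE_I2 tendsto_mult U(4) tendsto_const)
      have "C \<ge> 0" using U(2)[of 0 0] by linarith
      then show "AE x in M. norm (U n (T x) * h x) \<le> norm (C * h x)" for n
        using U(2) by (intro AE_I2) (simp add: abs_mult mult_right_mono)
    qed
    from this[OF h(1) T(1)] this[OF h(2) T(2)] U(3) show ?thesis
      unfolding E_def using LIMSEQ_unique by (simp only:) blast
  qed
  have cont: "E \<psi>" if "continuous_on UNIV \<psi>" "\<And>z. \<bar>\<psi> z\<bar> \<le> C" for \<psi> C
    unfolding E_def using eq that by blast
  have const: "E (\<lambda>_. c)" for c by (rule cont[of _ "\<bar>c\<bar>"]) auto
  have ind: "E (indicator A)" if "A \<in> sets borel" for A :: "real set"
  proof -
    have bs: "sigma_sets UNIV (range (\<lambda>a. {..a::real})) = sets borel"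
      by (simp add: borel_eq_atMost)
    have "Int_stable (range (\<lambda>a. {..a::real}))"
      by (auto simp: Int_stable_def)
    moreover have "range (\<lambda>a. {..a::real}) \<subseteq> Pow UNIV" by simp
    moreover have "A \<in> sigma_sets UNIV (range (\<lambda>a. {..a::real}))"
      using that bs by simp
    ultimately show ?thesis
    proof (induction rule: sigma_sets_induct_disjoint)
      case (basic A)
      then obtain a where A: "A = {..a}" by auto
      \<comment> \<open>For n > 0 this ramp is 1 up to a and reaches 0 at a + 1/n; it approximates
        the indicator of the closed half-line from above.\<close>
      define U where "U = (\<lambda>n z. max 0 (min 1 (1 - real n * (z - a))))"
      show ?case
      proof (rule lim[of U 1])
        have c: "continuous_on UNIV (U n)" for n
          unfolding U_def by (intro continuous_intros)
        show b: "\<bar>U n z\<bar> \<le> 1" for n z by (auto simp: U_def)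
        show "U n \<in> borel_measurable borel" for n
          by (rule borel_measurable_continuous_onI[OF c])
        show "E (U n)" for n by (rule cont[OF c b])
        show "(\<lambda>n. U n z) \<longlonglongrightarrow> indicator A z" for z
        proof (cases "z \<le> a")
          case True
          then have "real n * (z - a) \<le> 0" for n by (simp add: mult_nonneg_nonpos)
          then have "U n z = 1" for n by (simp add: U_def)
          then show ?thesis using True A by simp
        next
          case False
          then obtain N where N: "1 < real N * (z - a)"
            using reals_Archimedean3[of "z - a"] by (auto simp: mult.commute)
          have "\<forall>\<^sub>F n in sequentially. U n z = 0"
          proof (rule eventually_sequentiallyI[of N])
            fix n assume "N \<le> n"
            then have "real N * (z - a) \<le> real n * (z - a)"
              using False by (intro mult_right_mono) auto
            with N show "U n z = 0" by (simp add: U_def)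
          qed
          then show ?thesis using False A by (simp add: tendsto_eventually)
        qed
      qed
    next
      case empty
      show ?case using const[of 0] by (simp add: indicator_def)
    next
      case (compl A)
      then have "A \<in> sets borel" by (simp add: bs)
      then have "E (\<lambda>z. 1 * 1 + (-1) * indicator A z)"
        by (intro lin[of "\<lambda>_. 1" 1 "indicator A" 1] const compl)
          (auto simp: indicator_def)
      also have "(\<lambda>z. 1 * 1 + (-1) * indicator A z) = (indicator (UNIV - A) :: real \<Rightarrow> real)"
        by (auto simp: indicator_def)
      finally show ?case .
    next
      case (union F)
      then have F: "F i \<in> sets borel" for i by (auto simp: bs)
      have dis: "indicator (\<Union>i<n. F i) z = (\<Sum>i<n. indicator (F i) z :: real)" for n z
        using union(1) by (intro indicator_UN_disjoint) (auto simp: disjoint_family_on_def)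
      have m: "(\<Union>i<n. F i) \<in> sets borel" for n using F by auto
      \<comment> \<open>Finite disjoint unions are reached by linearity, the countable union
        afterwards as their bounded limit.\<close>
      have En: "E (indicator (\<Union>i<n. F i))" for n
      proof (induction n)
        case 0
        show ?case using const[of 0] by (simp add: indicator_def)
      next
        case (Suc n)
        have "E (\<lambda>z. 1 * indicator (\<Union>i<n. F i) z + 1 * indicator (F n) z)"
          by (intro lin[of _ 1 _ 1] Suc union borel_measurable_indicator m F)
            (auto simp: indicator_def)
        also have "(\<lambda>z. 1 * indicator (\<Union>i<n. F i) z + 1 * indicator (F n) z) =
            (indicator (\<Union>i<Suc n. F i) :: real \<Rightarrow> real)"
          by (simp only: dis fun_eq_iff sum.lessThan_Suc mult_1 simp_thms)
        finally show ?case .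
      qed
      show ?case
      proof (rule lim[of "\<lambda>n. indicator (\<Union>i<n. F i)" 1])
        show "(\<lambda>n. indicat_real (\<Union>i<n. F i) z) \<longlonglongrightarrow> indicator (\<Union> (range F)) z" for z
          using LIMSEQ_indicator_UN[of F z] by simp
        show "indicat_real (\<Union>i<n. F i) \<in> borel_measurable borel" for n
          by (rule borel_measurable_indicator[OF m])
        show "\<bar>indicat_real (\<Union>i<n. F i) z\<bar> \<le> 1" for n z
          by (simp add: indicator_def)
      qed (rule En)
    qed
  qed
  \<comment> \<open>Boundedness sits inside the induction claim because it has to be passed down:
    nonnegative summands and the members of an increasing sequence inherit the bound of the
    whole.\<close>
  have pos: "(\<exists>C. \<forall>z. u z \<le> C) \<longrightarrow> E u" if "u \<in> borel_measurable borel" "\<And>z. 0 \<le> u z" for u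
    using that
  proof (induction rule: borel_measurable_induct_real)
    case (set A)
    then show ?case using ind by simp
  next
    case (mult u c)
    show ?case
    proof
      assume "\<exists>C. \<forall>z. c * u z \<le> C"
      then obtain C where C: "\<And>z. c * u z \<le> C" by blast
      show "E (\<lambda>z. c * u z)"
      proof (cases "c = 0")
        case True
        then show ?thesis using const[of 0] by simp
      next
        case False
        then have "u z \<le> C / c" for z using C[of z] mult(1) by (simp add: field_simps)
        moreover from this have "E u" using mult(4) by blast
        ultimately show ?thesis
          using lin[of u "C / c" u "C / c" c 0] mult(2,3) by simp
      qed
    qed
  next
    case (add u v)
    show ?case
    proof
      assume "\<exists>C. \<forall>z. v z + u z \<le> C"
      then obtain C where C: "\<And>z. v z + u z \<le> C" by blast
      have uv: "0 \<le> u z" "0 \<le> v z" for z using add by auto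
      have b: "u z \<le> C" "v z \<le> C" for z using C[of z] uv[of z] by linarith+
      then have "E u" "E v" using add by blast+
      then show "E (\<lambda>z. v z + u z)"
        using lin[of v C u C 1 1] add b uv by simp
    qed
  next
    case (seq U)
    show ?case
    proof
      assume "\<exists>C. \<forall>z. u z \<le> C"
      then obtain C where C: "\<And>z. u z \<le> C" by blast
      have conv: "(\<lambda>i. U i z) \<longlonglongrightarrow> u z" for z using seq by simp
      have "incseq (\<lambda>i. U i z)" for z using \<open>incseq U\<close> by (auto simp: incseq_def le_fun_def)
      then have le: "U i z \<le> C" for i z
        using incseq_le[OF _ conv] C order_trans by blast
      then have "E (U i)" for i using seq by blast
      then show "E u"
        using \<open>\<And>i x. 0 \<le> U i x\<close> le
        by (intro lim[OF \<open>\<And>i. U i \<in> borel_measurable borel\<close> _ _ conv, of C]) auto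
    qed
  qed
  have "C \<ge> 0" using u(2)[of 0] by linarith
  \<comment> \<open>Adding C makes u nonnegative; linearity subtracts the constant again.\<close>
  have uC: "0 \<le> u z + C" "u z + C \<le> 2 * C" for z using u(2)[of z] by linarith+
  have "E (\<lambda>z. u z + C)"
  proof (rule pos[THEN mp])
    show "(\<lambda>z. u z + C) \<in> borel_measurable borel" using u(1) by simp
    show "\<exists>D. \<forall>z. u z + C \<le> D" using uC(2) by blast
  qed (rule uC(1))
  then have "E (\<lambda>z. 1 * (u z + C) + (-1) * C)"
    by (intro lin[of _ "2 * C" _ C] const) (use u(1) uC \<open>C \<ge> 0\<close> in auto)
  then show ?thesis by (simp add: E_def)
qed

text \<open>On a short interval the mean value theorem gives \<Psi>(Y t) - \<Psi>(Y s) =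
  \<psi>(\<xi>) (Y t - Y s), which is the integral of \<psi>(\<xi>) P and differs from that of
  \<psi>(Y) P by at most 2e times the integral of |P|. This bound adds up over adjacent intervals,
  so bisection carries it to \<open>{a..b}\<close>, and e is arbitrary. No pointwise derivative of Y
  is involved.\<close>

lemma chain_rule_integral_C1:
  fixes P Y :: "real \<Rightarrow> real"
  assumes ab: "a \<le> b" and P: "P absolutely_integrable_on {a..b}"
    and ac: "\<And>s t. a \<le> s \<Longrightarrow> s \<le> t \<Longrightarrow> t \<le> b \<Longrightarrow> (P has_integral Y t - Y s) {s..t}"
    and Y: "continuous_on {a..b} Y"
    and \<psi>: "continuous_on UNIV \<psi>" and \<Psi>: "\<And>z. (\<Psi> has_real_derivative \<psi> z) (at z)"
  shows "(\<lambda>t. \<psi> (Y t) * P t) absolutely_integrable_on {a..b}" (is "?f absolutely_integrable_on _")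
    and "((\<lambda>t. \<psi> (Y t) * P t) has_integral \<Psi> (Y b) - \<Psi> (Y a)) {a..b}"
proof -
  have c: "continuous_on {a..b} (\<lambda>t. \<psi> (Y t))"
    by (rule continuous_on_compose2[OF \<psi> Y]) simp
  show f: "?f absolutely_integrable_on {a..b}"
    by (intro absolutely_integrable_bounded_measurable_product_real P
        continuous_imp_measurable_on_sets_lebesgue c compact_imp_bounded compact_continuous_image) auto
  have sub: "g absolutely_integrable_on {s..t}" if "a \<le> s" "t \<le> b" "g absolutely_integrable_on {a..b}" for g :: "real \<Rightarrow> real" and s t
    using that by (intro absolutely_integrable_on_subinterval[OF that(3)]) auto
  define D where "D = (\<lambda>s t. \<bar>\<Psi> (Y t) - \<Psi> (Y s) - integral {s..t} ?f\<bar>)"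
  define I where "I = (\<lambda>s t. integral {s..t} (\<lambda>x. \<bar>P x\<bar>))"
  have comb: "integral {s..u} g = integral {s..t} g + integral {t..u} g"
    if "a \<le> s" "s \<le> t" "t \<le> u" "u \<le> b" "g absolutely_integrable_on {a..b}" for g :: "real \<Rightarrow> real" and s t u
    using that sub[of s u g] by (intro Henstock_Kurzweil_Integration.integral_combine[symmetric]
        set_lebesgue_integral_eq_integral(1)) auto
  have key: "D a b \<le> 2 * e * I a b" if e: "e > 0" for e
  proof -
    define Q where "Q = (\<lambda>s t. a \<le> s \<longrightarrow> t \<le> b \<longrightarrow> s \<le> t \<longrightarrow> D s t \<le> 2 * e * I s t)"
    have "Q a b"
    proof (rule Bolzano[OF ab])
      fix s t u assume "Q s t" "Q t u" "s \<le> t" "t \<le> u"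
      show "Q s u"
        unfolding Q_def
      proof (intro impI)
        assume su: "a \<le> s" "u \<le> b" "s \<le> u"
        have "D s t \<le> 2 * e * I s t" "D t u \<le> 2 * e * I t u"
          using \<open>Q s t\<close> \<open>Q t u\<close> su \<open>s \<le> t\<close> \<open>t \<le> u\<close> by (auto simp: Q_def)
        moreover have "I s u = I s t + I t u"
          unfolding I_def using su \<open>s \<le> t\<close> \<open>t \<le> u\<close> P
          by (intro comb set_integrable_abs) auto
        moreover have "integral {s..u} ?f = integral {s..t} ?f + integral {t..u} ?f"
          using su \<open>s \<le> t\<close> \<open>t \<le> u\<close> by (intro comb f) auto
        then have "D s u \<le> D s t + D t u" unfolding D_def by linarith
        ultimately show "D s u \<le> 2 * e * I s u" by (simp add: algebra_simps)
      qed
    next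
      fix x assume x: "a \<le> x" "x \<le> b"
      obtain d where d: "d > 0" "\<And>z. \<bar>z - Y x\<bar> < d \<Longrightarrow> \<bar>\<psi> z - \<psi> (Y x)\<bar> < e"
        using \<psi> e unfolding continuous_on_iff dist_real_def by (metis UNIV_I)
      obtain r where r: "r > 0" "\<And>t. t \<in> {a..b} \<Longrightarrow> \<bar>t - x\<bar> < r \<Longrightarrow> \<bar>Y t - Y x\<bar> < d"
        using Y x d(1) unfolding continuous_on_iff dist_real_def by (metis atLeastAtMost_iff)
      show "\<exists>d>0. \<forall>s t. s \<le> x \<and> x \<le> t \<and> t - s < d \<longrightarrow> Q s t"
      proof (intro exI[of _ r] conjI r allI impI)
        fix s t assume st: "s \<le> x \<and> x \<le> t \<and> t - s < r"
        show "Q s t"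
          unfolding Q_def
        proof (intro impI)
          assume ab': "a \<le> s" "t \<le> b" "s \<le> t"
          have near: "\<bar>Y y - Y x\<bar> < d" if "y \<in> {s..t}" for y
            using st ab' that by (intro r(2)) auto
          have "\<exists>\<xi>. \<bar>\<xi> - Y x\<bar> < d \<and> \<Psi> (Y t) - \<Psi> (Y s) = (Y t - Y s) * \<psi> \<xi>"
          proof -
            consider "Y s < Y t" | "Y t < Y s" | "Y s = Y t" by linarith
            then show ?thesis
            proof cases
              case 1
              then obtain \<xi> where "Y s < \<xi>" "\<xi> < Y t" "\<Psi> (Y t) - \<Psi> (Y s) = (Y t - Y s) * \<psi> \<xi>"
                using MVT2[of "Y s" "Y t" \<Psi> \<psi>] \<Psi> by blast
              then show ?thesis using near[of s] near[of t] ab' by (intro exI[of _ \<xi>]) auto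
            next
              case 2
              then obtain \<xi> where "Y t < \<xi>" "\<xi> < Y s" "\<Psi> (Y s) - \<Psi> (Y t) = (Y s - Y t) * \<psi> \<xi>"
                using MVT2[of "Y t" "Y s" \<Psi> \<psi>] \<Psi> by blast
              then show ?thesis using near[of s] near[of t] ab'
                by (intro exI[of _ \<xi>]) (auto simp: algebra_simps)
            next
              case 3
              then show ?thesis using d(1) by (intro exI[of _ "Y x"]) simp
            qed
          qed
          then obtain \<xi> where \<xi>: "\<bar>\<xi> - Y x\<bar> < d" "\<Psi> (Y t) - \<Psi> (Y s) = (Y t - Y s) * \<psi> \<xi>" by blast
          have Pst: "P absolutely_integrable_on {s..t}" "?f absolutely_integrable_on {s..t}"
            using sub ab' P f by blast+
          have "((\<lambda>y. \<psi> \<xi> * P y - ?f y) has_integral \<psi> \<xi> * (Y t - Y s) - integral {s..t} ?f) {s..t}"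
            using Pst(2) ab' by (intro has_integral_diff has_integral_mult_right ac integrable_integral
                set_lebesgue_integral_eq_integral(1)) auto
          moreover have "((\<lambda>y. 2 * e * \<bar>P y\<bar>) has_integral 2 * e * I s t) {s..t}"
            unfolding I_def using set_integrable_abs[OF Pst(1)]
            by (intro has_integral_mult_right integrable_integral set_lebesgue_integral_eq_integral(1))
          moreover have "norm (\<psi> \<xi> * P y - ?f y) \<le> 2 * e * \<bar>P y\<bar>" if "y \<in> {s..t}" for y
          proof -
            \<comment> \<open>Both \<open>\<xi>\<close> and \<open>Y y\<close> lie within d of
              \<open>Y x\<close>; each comparison with \<open>\<psi> (Y x)\<close> costs e.\<close>
            have "\<bar>\<psi> \<xi> - \<psi> (Y y)\<bar> \<le> 2 * e"
              using d(2)[OF \<xi>(1)] d(2)[OF near[OF that]] by linarith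
            then have "\<bar>(\<psi> \<xi> - \<psi> (Y y)) * P y\<bar> \<le> 2 * e * \<bar>P y\<bar>"
              by (simp add: abs_mult mult_right_mono)
            then show ?thesis by (simp add: left_diff_distrib)
          qed
          ultimately have "norm (\<psi> \<xi> * (Y t - Y s) - integral {s..t} ?f) \<le> 2 * e * I s t"
            by (metis (no_types, lifting) has_integral_integrable integral_norm_bound_integral integral_unique)
          then show "D s t \<le> 2 * e * I s t" using \<xi>(2) by (simp add: D_def mult.commute)
        qed
      qed
    qed
    then show ?thesis using ab by (simp add: Q_def)
  qed
  have "I a b \<ge> 0" unfolding I_def
    by (intro Henstock_Kurzweil_Integration.integral_nonneg set_lebesgue_integral_eq_integral(1) set_integrable_abs P) auto
  have "D a b \<le> 0"
  proof (rule field_le_epsilon)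
    fix e :: real assume "e > 0"
    \<comment> \<open>The summand 1 keeps the denominator positive when
      \<open>I a b = 0\<close>.\<close>
    have "D a b \<le> 2 * (e / (2 * (I a b + 1))) * I a b"
      using \<open>e > 0\<close> \<open>I a b \<ge> 0\<close> by (intro key) auto
    also have "\<dots> \<le> e" using \<open>e > 0\<close> \<open>I a b \<ge> 0\<close> by (simp add: field_simps)
    finally show "D a b \<le> 0 + e" by simp
  qed
  then have "integral {a..b} ?f = \<Psi> (Y b) - \<Psi> (Y a)" by (simp add: D_def)
  then show "(?f has_integral \<Psi> (Y b) - \<Psi> (Y a)) {a..b}"
    using f set_lebesgue_integral_eq_integral(1) integrable_integral by metis
qed

text \<open>Both sides integrate \<phi> against signed measures on the range of Y: the oriented
  Lebesgue measure between Y a and Y b, and the image under Y of the measure with density P. The C1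
  case makes them agree on continuous functions, and the monotone class argument does the
  rest.\<close>

lemma chain_rule_integral_bounded_borel:
  fixes P Y \<phi> :: "real \<Rightarrow> real"
  assumes ab: "a \<le> b" and P: "P absolutely_integrable_on {a..b}"
    and ac: "\<And>s t. a \<le> s \<Longrightarrow> s \<le> t \<Longrightarrow> t \<le> b \<Longrightarrow> (P has_integral Y t - Y s) {s..t}"
    and Y: "continuous_on {a..b} Y"
    and \<phi>: "\<phi> \<in> borel_measurable borel" "\<And>z. \<bar>\<phi> z\<bar> \<le> C"
  shows "((\<lambda>t. \<phi> (Y t) * P t) has_integral (LBINT z=Y a..Y b. \<phi> z)) {a..b}"
proof -
  \<comment> \<open>A signed indicator, so that the oriented interval integral becomes an integral
    with a density.\<close>
  define k :: "real \<Rightarrow> real" where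
    "k = (\<lambda>z. if Y a \<le> Y b then indicator {Y a<..<Y b} z else - indicator {Y b<..<Y a} z)"
  have kint: "integrable lborel k" by (cases "Y a \<le> Y b") (auto simp: k_def)
  have LB: "(LBINT z=Y a..Y b. u z) = (\<integral>z. u (id z) * k z \<partial>lborel)" for u
    by (simp add: interval_lebesgue_integral_def k_def set_lebesgue_integral_def mult.commute
        flip: Bochner_Integration.integral_minus)
  define h where "h = (\<lambda>t. indicator {a..b} t * P t)"
  \<comment> \<open>Y is continued by its endpoint values to be measurable on the whole line;
    \<open>h\<close> vanishes where the two differ.\<close>
  define T where "T = (\<lambda>t. Y (max a (min b t)))"
  have hint: "integrable lebesgue h" using P by (simp add: set_integrable_def h_def)
  have "continuous_on UNIV T"
    unfolding T_def by (intro continuous_on_compose2[OF Y] continuous_intros) (use ab in auto)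
  then have T: "T \<in> borel_measurable lebesgue"
    by (intro measurable_completion) (simp add: borel_measurable_continuous_onI)
  have Teq: "T t = Y t" if "t \<in> {a..b}" for t using that by (simp add: T_def max_absorb2 min_absorb2)
  have conv: "(\<integral>t. u (T t) * h t \<partial>lebesgue) = (LINT t:{a..b}|lebesgue. u (Y t) * P t)" for u
    unfolding set_lebesgue_integral_def h_def
    by (rule Bochner_Integration.integral_cong) (auto simp: indicator_def Teq)
  have "(\<integral>z. \<phi> (id z) * k z \<partial>lborel) = (\<integral>t. \<phi> (T t) * h t \<partial>lebesgue)"
  proof (rule integral_eq_of_continuous_bounded[OF kint hint _ T _ \<phi>])
    fix \<psi> :: "real \<Rightarrow> real" and C assume \<psi>: "continuous_on UNIV \<psi>"
    then have "\<exists>F. \<forall>x::real. -\<infinity> < ereal x \<longrightarrow> ereal x < \<infinity> \<longrightarrow> (F has_vector_derivative \<psi> x) (at x)"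
      by (intro einterval_antiderivative) (auto simp: continuous_on_eq_continuous_at)
    then obtain \<Psi> where \<Psi>: "\<And>z. (\<Psi> has_real_derivative \<psi> z) (at z)"
      by (auto simp: has_real_derivative_iff_has_vector_derivative)
    note c1 = chain_rule_integral_C1[OF ab P ac Y \<psi> \<Psi>]
    have "(LBINT z=Y a..Y b. \<psi> z) = \<Psi> (Y b) - \<Psi> (Y a)"
      using \<Psi> \<psi> by (intro interval_integral_FTC_finite)
       (auto intro: continuous_on_subset has_field_derivative_at_within
          simp flip
: has_real_derivative_iff_has_vector_derivative)
    also have "\<dots> = (LINT t:{a..b}|lebesgue. \<psi> (Y t) * P t)"
      using c1 by (metis has_integral_set_lebesgue has_integral_unique)
    finally show "(\<integral>z. \<psi> (id z) * k z \<partial>lborel) = (\<integral>t. \<psi> (T t) * h t \<partial>lebesgue)"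
      by (simp only: LB conv)
  qed simp
  then have "(LBINT z=Y a..Y b. \<phi> z) = (LINT t:{a..b}|lebesgue. \<phi> (Y t) * P t)"
    by (simp only: LB conv)
  moreover have "(\<lambda>t. \<phi> (Y t) * P t) absolutely_integrable_on {a..b}"
  proof (rule absolutely_integrable_bounded_measurable_product_real[OF _ _ _ P])
    show "(\<lambda>x. \<phi> (Y x)) \<in> borel_measurable (lebesgue_on {a..b})"
      by (rule measurable_compose[OF continuous_imp_measurable_on_sets_lebesgue[OF Y] \<phi>(1)]) simp
    show "bounded ((\<lambda>x. \<phi> (Y x)) ` {a..b})"
      using \<phi>(2) by (auto simp: bounded_iff)
  qed simp
  ultimately show ?thesis by (metis has_integral_set_lebesgue)
qed

section \<open>The Lyapunov inequality\<close>

lemma bounded_measurable_absolutely_integrable: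
  assumes "u \<in> borel_measurable (lebesgue_on {-1..T::real})" "bounded (u ` {-1..T})"
  shows "(u :: real \<Rightarrow> real) absolutely_integrable_on {-1..T}"
  using absolutely_integrable_bounded_measurable_product_real[OF assms(1) _ assms(2), of "\<lambda>_. 1"]
  by (auto intro: absolutely_integrable_on_const)

lemma absolutely_integrable_on_window:
  assumes "\<And>T. u absolutely_integrable_on {-1..T}" "-1 \<le> a"
  shows "(u :: real \<Rightarrow> real) absolutely_integrable_on {a..b}"
  by (rule absolutely_integrable_on_subinterval[OF assms(1)[of b]]) (use assms(2) in auto)

text \<open>\<open>P\<close> plays the weak derivative and \<open>Y\<close> a primitive of it on the
  closed half-line from -1. The endpoint is included because the Lyapunov functional at time 0
  involves Y(-1), where the solution itself has no prescribed value.\<close>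

locale delay_trajectory =
  fixes c \<gamma> :: real and f g P Y :: "real \<Rightarrow> real"
  assumes c2: "c\<^sup>2 = 1" and f_cont: "continuous_on UNIV f" and f_mono: "strict_mono f" and f0: "f 0 = 0"
    and g_meas: "g \<in> borel_measurable borel"
    and \<gamma>: "0 \<le> \<gamma>" "\<gamma> < 1" and g_le: "\<And>x. \<bar>g x\<bar> \<le> \<gamma> * \<bar>f x\<bar>"
    and P1: "\<And>T. P absolutely_integrable_on {-1..T}"
    and P2: "\<And>T. (\<lambda>t. (P t)\<^sup>2) absolutely_integrable_on {-1..T}"
    and ac: "\<And>s t. -1 \<le> s \<Longrightarrow> s \<le> t \<Longrightarrow> (P has_integral Y t - Y s) {s..t}"
    and eqn: "AE t in lebesgue. t > 0 \<longrightarrow> P t + c * P (t - 1) + f (Y t) + g (Y (t - 1)) = 0"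
begin

text \<open>The integrand of the modified potential. Subtracting \<open>c * g\<close> collects all
  terms linear in \<open>P\<close> that arise when \<open>w\<^sup>2\<close> is compared with its
  value one delay later.\<close>

definition \<phi> :: "real \<Rightarrow> real" where "\<phi> z = f z - c * g z"

definition w :: "real \<Rightarrow> real" where "w t = P t + f (Y t)"

section \<open>Continuity and integrability along the trajectory\<close>

lemma Y_cont: "continuous_on {-1..T} Y"
proof (cases "-1 \<le> T")
  case True
  have "P integrable_on {-1..T}" by (rule set_lebesgue_integral_eq_integral(1)[OF P1])
  then have "continuous_on {-1..T} (\<lambda>t. Y (-1) + integral {-1..t} P)"
    by (intro continuous_intros indefinite_integral_continuous_1)
  then show ?thesis
    by (rule continuous_on_eq) (use integral_unique[OF ac[OF order_refl]] in auto)
qed auto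

lemma fY_cont: "continuous_on {-1..T} (\<lambda>t. f (Y t))"
  by (rule continuous_on_compose2[OF f_cont Y_cont]) simp

lemma fY_bounded_meas:
  "(\<lambda>t. f (Y t)) \<in> borel_measurable (lebesgue_on {-1..T})" "bounded ((\<lambda>t. f (Y t)) ` {-1..T})"
  by (intro continuous_imp_measurable_on_sets_lebesgue fY_cont compact_imp_bounded
      compact_continuous_image compact_Icc; simp)+

lemma gY_bounded_meas:
  "(\<lambda>t. g (Y t)) \<in> borel_measurable (lebesgue_on {-1..T})" "bounded ((\<lambda>t. g (Y t)) ` {-1..T})"
proof -
  show "(\<lambda>t. g (Y t)) \<in> borel_measurable (lebesgue_on {-1..T})"
    by (rule measurable_compose[OF continuous_imp_measurable_on_sets_lebesgue[OF Y_cont] g_meas]) simp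
  obtain C where C: "\<And>t. t \<in> {-1..T} \<Longrightarrow> \<bar>f (Y t)\<bar> \<le> C"
    using fY_bounded_meas(2)[of T] unfolding bounded_real by blast
  have "\<bar>g (Y t)\<bar> \<le> \<gamma> * C" if "t \<in> {-1..T}" for t
    using g_le[of "Y t"] mult_left_mono[OF C[OF that] \<gamma>(1)] by linarith
  then show "bounded ((\<lambda>t. g (Y t)) ` {-1..T})"
    unfolding bounded_real by blast
qed

lemma fY_gY_integrable:
  "(\<lambda>t. f (Y t) * P t) absolutely_integrable_on {-1..T}"
  "(\<lambda>t. g (Y t) * P t) absolutely_integrable_on {-1..T}"
  "(\<lambda>t. (f (Y t))\<^sup>2) absolutely_integrable_on {-1..T}"
  "(\<lambda>t. (g (Y t))\<^sup>2) absolutely_integrable_on {-1..T}"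
proof -
  show "(\<lambda>t. f (Y t) * P t) absolutely_integrable_on {-1..T}"
    "(\<lambda>t. g (Y t) * P t) absolutely_integrable_on {-1..T}"
    by (intro absolutely_integrable_bounded_measurable_product_real fY_bounded_meas gY_bounded_meas P1; simp)+
  have "(\<lambda>t. f (Y t)) absolutely_integrable_on {-1..T}" "(\<lambda>t. g (Y t)) absolutely_integrable_on {-1..T}"
    by (intro bounded_measurable_absolutely_integrable fY_bounded_meas gY_bounded_meas)+
  then show "(\<lambda>t. (f (Y t))\<^sup>2) absolutely_integrable_on {-1..T}"
    "(\<lambda>t. (g (Y t))\<^sup>2) absolutely_integrable_on {-1..T}"
    unfolding power2_eq_square
    by (intro absolutely_integrable_bounded_measurable_product_real fY_bounded_meas gY_bounded_meas; simp)+
qed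

lemma w2_integrable: "(\<lambda>t. (w t)\<^sup>2) absolutely_integrable_on {-1..T}"
proof -
  have "(\<lambda>t. (P t)\<^sup>2 + 2 * (f (Y t) * P t) + (f (Y t))\<^sup>2) absolutely_integrable_on {-1..T}"
    by (intro set_integral_add(1) P2 fY_gY_integrable set_integrable_mult_right)
  then show ?thesis by (simp add: w_def power2_sum algebra_simps)
qed

section \<open>The modified potential and its chain rule along the trajectory\<close>

lemma abs_c: "\<bar>c\<bar> = 1" using c2 by (simp add: power2_eq_1_iff) auto

lemma \<phi>_bound: "\<bar>\<phi> z\<bar> \<le> 2 * \<bar>f z\<bar>"
proof -
  have "\<bar>c * g z\<bar> \<le> \<bar>f z\<bar>"
    using g_le[of z] \<gamma> abs_c mult_right_mono[of \<gamma> 1 "\<bar>f z\<bar>"] by (simp add: abs_mult)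
  then show ?thesis unfolding \<phi>_def by linarith
qed

lemma f_meas: "f \<in> borel_measurable borel" by (rule borel_measurable_continuous_onI[OF f_cont])

lemma \<phi>_meas: "\<phi> \<in> borel_measurable borel"
  unfolding \<phi>_def[abs_def] using f_meas g_meas by measurable

lemma f_interval_integrable: "interval_lebesgue_integrable lborel (ereal a) (ereal b) f"
  using f_cont by (intro interval_integrable_isCont) (simp add: continuous_on_eq_continuous_at)

lemma \<phi>_interval_integrable: "interval_lebesgue_integrable lborel (ereal a) (ereal b) \<phi>"
proof -
  have "set_integrable lborel (einterval (ereal a) (ereal b)) \<phi>"
    if "interval_lebesgue_integrable lborel (ereal a) (ereal b) f" "a \<le> b" for a b
  proof (rule set_integrable_bound)
    show "set_integrable lborel (einterval (ereal a) (ereal b)) (\<lambda>z. 2 * f z)"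
      using that by (simp add: interval_lebesgue_integrable_def)
    show "set_borel_measurable lborel (einterval (ereal a) (ereal b)) \<phi>"
      unfolding set_borel_measurable_def using \<phi>_meas by measurable
    show "AE z in lborel. z \<in> einterval (ereal a) (ereal b) \<longrightarrow> norm (\<phi> z) \<le> norm (2 * f z)"
      using \<phi>_bound by (simp add: abs_mult)
  qed
  from this[OF f_interval_integrable, of a b] this[OF f_interval_integrable, of b a] show ?thesis
    by (simp add: interval_lebesgue_integrable_def)
qed

text \<open>\<open>\<phi>\<close> need not be bounded on the line, but Y stays in a compact interval
  \<open>{-R..R}\<close> up to time T, and truncating \<open>\<phi>\<close> outside it changes
  neither side.\<close>

lemma chain_rule_trajectory:
  assumes T: "-1 \<le> T"
  shows "((\<lambda>s. \<phi> (Y s) * P s) has_integral (LBINT z=Y (-1)..Y T. \<phi> z)) {-1..T}"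
proof -
  have "bounded (Y ` {-1..T})"
    by (intro compact_imp_bounded compact_continuous_image Y_cont) simp
  then obtain R where R: "\<And>t. t \<in> {-1..T} \<Longrightarrow> \<bar>Y t\<bar> \<le> R" unfolding bounded_real by blast
  have "bounded (f ` {-R..R})"
    by (intro compact_imp_bounded compact_continuous_image continuous_on_subset[OF f_cont]) auto
  then obtain C where C: "\<And>z. z \<in> {-R..R} \<Longrightarrow> \<bar>f z\<bar> \<le> C" unfolding bounded_real by blast
  have "0 \<in> {-R..R}" using R[of "-1"] T by auto
  then have "C \<ge> 0" using C[of 0] by linarith
  define \<psi> where "\<psi> = (\<lambda>z. indicator {-R..R} z * \<phi> z)"
  have "((\<lambda>s. \<psi> (Y s) * P s) has_integral (LBINT z=Y (-1)..Y T. \<psi> z)) {-1..T}"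
  proof (rule chain_rule_integral_bounded_borel[OF T P1 ac Y_cont])
    show "\<psi> \<in> borel_measurable borel" unfolding \<psi>_def using \<phi>_meas by measurable
    show "\<bar>\<psi> z\<bar> \<le> 2 * C" for z
      using \<phi>_bound[of z] C[of z] \<open>C \<ge> 0\<close> by (auto simp: \<psi>_def indicator_def)
  qed
  moreover have "(LBINT z=Y (-1)..Y T. \<psi> z) = (LBINT z=Y (-1)..Y T. \<phi> z)"
  proof (rule interval_integral_cong)
    fix z assume "z \<in> einterval (min (ereal (Y (-1))) (ereal (Y T))) (max (ereal (Y (-1))) (ereal (Y T)))"
    then have "min (Y (-1)) (Y T) < z" "z < max (Y (-1)) (Y T)"
      by (auto simp: einterval_def min_def max_def split: if_splits)
    then have "z \<in> {-R..R}" using R[of "-1"] R[of T] T by auto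
    then show "\<psi> z = \<phi> z" by (simp add: \<psi>_def)
  qed
  ultimately have "((\<lambda>s. \<psi> (Y s) * P s) has_integral (LBINT z=Y (-1)..Y T. \<phi> z)) {-1..T}"
    by (simp only:)
  moreover have "\<psi> (Y s) * P s = \<phi> (Y s) * P s" if "s \<in> {-1..T}" for s
    using R[OF that] by (simp add: \<psi>_def indicator_def abs_le_iff)
  ultimately show ?thesis by (rule has_integral_eq[rotated])
qed

text \<open>Because \<open>c\<^sup>2 = 1\<close>, the equation turns \<open>(w t)\<^sup>2\<close>
  into the value at \<open>t - 1\<close> of q = (P + c g(Y))^2. Hence the energy changes by the
  integral of q - w^2 over \<open>{-1..T-1}\<close>, in which the squares of P cancel.\<close>

lemma energy_identity:
  assumes T: "0 \<le> T"
  shows "integral {T-1..T} (\<lambda>t. (w t)\<^sup>2) = integral {-1..0} (\<lambda>t. (w t)\<^sup>2)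
    - 2 * (LBINT z=Y (-1)..Y (T - 1). \<phi> z) - integral {-1..T-1} (\<lambda>t. (f (Y t))\<^sup>2 - (g (Y t))\<^sup>2)"
proof -
  let ?W = "\<lambda>t. (w t)\<^sup>2"
  define q where "q = (\<lambda>s. (P s)\<^sup>2 + 2 * c * (g (Y s) * P s) + (g (Y s))\<^sup>2)"
  have qi: "q absolutely_integrable_on {-1..T-1}"
    unfolding q_def by (intro set_integral_add(1) P2 fY_gY_integrable set_integrable_mult_right)
  then have "(q has_integral integral {-1..T-1} q) {-1..T-1}"
    by (intro integrable_integral set_lebesgue_integral_eq_integral(1))
  then have q1: "((\<lambda>t. q (t - 1)) has_integral integral {-1..T-1} q) {0..T}"
    using has_integral_shift_real_ivl_iff[of q "integral {-1..T-1} q" "-1" "T - 1" "-1"] by simp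
  obtain N where N: "\<And>t. t \<in> space lebesgue - N \<Longrightarrow> t > 0 \<longrightarrow> P t + c * P (t - 1) + f (Y t) + g (Y (t - 1)) = 0"
    "N \<in> null_sets lebesgue"
    using eqn by (rule AE_E3) (rule that)
  have "(?W has_integral integral {-1..T-1} q) {0..T}"
  proof (rule has_integral_spike[OF _ _ q1])
    \<comment> \<open>The point 0 joins the exceptional set because the equation is only imposed for
      t > 0.\<close>
    show "negligible (N \<union> {0})" using N(2) by (simp add: negligible_iff_null_sets[symmetric])
    fix t assume "t \<in> {0..T} - (N \<union> {0})"
    then have "P t + c * P (t - 1) + f (Y t) + g (Y (t - 1)) = 0" using N(1)[of t] by auto
    then have wt: "w t = - (c * P (t - 1) + g (Y (t - 1)))" by (simp add: w_def)
    have "?W t = c\<^sup>2 * (P (t - 1))\<^sup>2 + 2 * c * (g (Y (t - 1)) * P (t - 1)) + (g (Y (t - 1)))\<^sup>2"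
      unfolding wt by (simp add: power2_eq_square algebra_simps)
    then show "?W t = q (t - 1)" by (simp add: c2 q_def)
  qed
  then have W0: "integral {0..T} ?W = integral {-1..T-1} q" by (rule integral_unique)
  have Wi: "?W integrable_on {-1..t}" for t by (rule set_lebesgue_integral_eq_integral(1)[OF w2_integrable])
  \<comment> \<open>Cutting the same interval at 0 and at \<open>T-1\<close> compares the two energy
    windows even when they overlap, that is for T < 1.\<close>
  have "integral {-1..0} ?W + integral {0..T} ?W = integral {-1..T} ?W"
    "integral {-1..T-1} ?W + integral {T-1..T} ?W = integral {-1..T} ?W"
    using T by (intro Henstock_Kurzweil_Integration.integral_combine Wi; simp)+
  moreover have "integral {-1..T-1} ?W - integral {-1..T-1} q = integral {-1..T-1} (\<lambda>t. ?W t - q t)"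
    by (intro Henstock_Kurzweil_Integration.integral_diff[symmetric] Wi set_lebesgue_integral_eq_integral(1)[OF qi])
  moreover have Wq: "(\<lambda>t. ?W t - q t) = (\<lambda>t. 2 * (\<phi> (Y t) * P t) + ((f (Y t))\<^sup>2 - (g (Y t))\<^sup>2))"
    by (simp add: fun_eq_iff w_def q_def \<phi>_def power2_eq_square algebra_simps)
  moreover have "integral {-1..T-1} (\<lambda>t. ?W t - q t) =
      2 * (LBINT z=Y (-1)..Y (T - 1). \<phi> z) + integral {-1..T-1} (\<lambda>t. (f (Y t))\<^sup>2 - (g (Y t))\<^sup>2)"
    unfolding Wq using T by (intro integral_unique has_integral_add has_integral_mult_right chain_rule_trajectory integrable_integral
        set_lebesgue_integral_eq_integral(1) set_integral_diff(1) fY_gY_integrable) simp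
  ultimately show ?thesis using W0 by linarith
qed

section \<open>Comparison of the potentials and the Lyapunov bounds\<close>

lemma f_sgn: "z > 0 \<Longrightarrow> f z > 0" "z < 0 \<Longrightarrow> f z < 0"
  using f_mono f0 unfolding strict_mono_def by force+

lemma potential_nonneg: "0 \<le> potential f x"
proof (cases "0 \<le> x")
  case True
  then have "0 \<le> (LBINT z:{0<..<x}. f z)"
    unfolding set_lebesgue_integral_def using f_sgn(1)
    by (intro Bochner_Integration.integral_nonneg) (auto simp: indicator_def less_imp_le)
  then show ?thesis using True
    by (simp add: potential_def interval_lebesgue_integral_def zero_ereal_def)
next
  case False
  then have "0 \<le> (LBINT z:{x<..<0}. - f z)"
    unfolding set_lebesgue_integral_def using f_sgn(2)
    by (intro Bochner_Integration.integral_nonneg) (auto simp: indicator_def less_imp_le)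
  then show ?thesis using False
    by (simp add: potential_def interval_lebesgue_integral_def zero_ereal_def set_lebesgue_integral_def)
qed

text \<open>Since |c g| is at most \<gamma> |f|, the integrand \<open>\<phi>\<close> lies above
  \<open>(1 - \<gamma>) * f\<close> on the positive axis and below it on the negative axis, where
  the orientation of the integral reverses the inequality.\<close>

lemma potential_le: "(1 - \<gamma>) * potential f x \<le> (LBINT z=0..x. \<phi> z)"
proof -
  have b: "c * g z \<le> \<gamma> * \<bar>f z\<bar>" "- (c * g z) \<le> \<gamma> * \<bar>f z\<bar>" for z
    using g_le[of z] abs_c abs_mult[of c "g z"] by (auto simp: abs_le_iff)
  note ii = f_interval_integrable[of 0 x, folded zero_ereal_def] f_interval_integrable[of x 0, folded zero_ereal_def]
    \<phi>_interval_integrable[of 0 x, folded zero_ereal_def] \<phi>_interval_integrable[of x 0, folded zero_ereal_def]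
  show ?thesis
  proof (cases "0 \<le> x")
    case True
    then have si: "set_integrable lborel {0<..<x} f" "set_integrable lborel {0<..<x} \<phi>"
      using ii by (auto simp: interval_lebesgue_integrable_def zero_ereal_def)
    have "(LBINT z:{0<..<x}. (1 - \<gamma>) * f z) \<le> (LBINT z:{0<..<x}. \<phi> z)"
    proof (rule set_integral_mono)
      show "(1 - \<gamma>) * f z \<le> \<phi> z" if "z \<in> {0<..<x}" for z
        using b(1)[of z] f_sgn(1)[of z] that by (simp add: \<phi>_def algebra_simps)
    qed (use si in auto)
    then show ?thesis using True
      by (simp add: potential_def interval_lebesgue_integral_def zero_ereal_def)
  next
    case False
    then have si: "set_integrable lborel {x<..<0} f" "set_integrable lborel {x<..<0} \<phi>"
      using ii by (auto simp: interval_lebesgue_integrable_def zero_ereal_def)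
    have "(LBINT z:{x<..<0}. \<phi> z) \<le> (LBINT z:{x<..<0}. (1 - \<gamma>) * f z)"
    proof (rule set_integral_mono)
      show "\<phi> z \<le> (1 - \<gamma>) * f z" if "z \<in> {x<..<0}" for z
        using b(2)[of z] f_sgn(2)[of z] that by (simp add: \<phi>_def algebra_simps)
    qed (use si in auto)
    then show ?thesis using False
      by (simp add: potential_def interval_lebesgue_integral_def zero_ereal_def)
  qed
qed

text \<open>The value of the Lyapunov functional at time \<open>0\<close>.\<close>

definition K :: real where "K = integral {-1..0} (\<lambda>t. (w t)\<^sup>2) + 2 * (LBINT z=0..Y (-1). \<phi> z)"

text \<open>This is the energy identity with the potential measured from 0 and with
  \<open>(f (Y t))\<^sup>2 - (g (Y t))\<^sup>2\<close> bounded below by the fraction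
  \<open>1 - \<gamma>\<^sup>2\<close> of the first square.\<close>

lemma lyapunov:
  assumes T: "0 \<le> T"
  shows "integral {T-1..T} (\<lambda>t. (w t)\<^sup>2) + 2 * (1 - \<gamma>) * potential f (Y (T - 1))
    + (1 - \<gamma>\<^sup>2) * integral {-1..T-1} (\<lambda>t. (f (Y t))\<^sup>2) \<le> K"
proof -
  \<comment> \<open>Additivity of the oriented integral through 0, Y(-1) and Y(T-1) requires
    integrability over the hull of the three points, in whatever order they lie.\<close>
  have "interval_lebesgue_integrable lborel (min (ereal 0) (min (ereal (Y (-1))) (ereal (Y (T-1)))))
      (max (ereal 0) (max (ereal (Y (-1))) (ereal (Y (T-1))))) \<phi>"
    using \<phi>_interval_integrable by (simp only: ereal_min ereal_max flip: ereal_min ereal_max)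
  from interval_integral_sum[OF this]
  have "(LBINT z=0..Y (-1). \<phi> z) + (LBINT z=Y (-1)..Y (T-1). \<phi> z) = (LBINT z=0..Y (T-1). \<phi> z)"
    by (simp add: zero_ereal_def)
  moreover have "(1 - \<gamma>\<^sup>2) * integral {-1..T-1} (\<lambda>t. (f (Y t))\<^sup>2) =
      integral {-1..T-1} (\<lambda>t. (1 - \<gamma>\<^sup>2) * (f (Y t))\<^sup>2)"
    by simp
  moreover have "integral {-1..T-1} (\<lambda>t. (1 - \<gamma>\<^sup>2) * (f (Y t))\<^sup>2) \<le>
      integral {-1..T-1} (\<lambda>t. (f (Y t))\<^sup>2 - (g (Y t))\<^sup>2)"
  proof (rule integral_le)
    fix t
    have "(g (Y t))\<^sup>2 \<le> (\<gamma> * \<bar>f (Y t)\<bar>)\<^sup>2"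
      using g_le[of "Y t"] by (metis abs_ge_zero power2_abs power_mono)
    then show "(1 - \<gamma>\<^sup>2) * (f (Y t))\<^sup>2 \<le> (f (Y t))\<^sup>2 - (g (Y t))\<^sup>2"
      by (simp add: power_mult_distrib algebra_simps)
  qed (intro set_lebesgue_integral_eq_integral(1) set_integral_diff(1) set_integrable_mult_right fY_gY_integrable)+
  ultimately show ?thesis
    using energy_identity[OF T] potential_le[of "Y (T - 1)"] unfolding K_def by linarith
qed

lemma one_minus_\<gamma>2_pos: "0 < 1 - \<gamma>\<^sup>2" using \<gamma> by (simp add: abs_square_less_1)

lemma lyapunov_terms_nonneg:
  "0 \<le> integral {a..b} (\<lambda>t. (w t)\<^sup>2)" "0 \<le> integral {a..b} (\<lambda>t. (f (Y t))\<^sup>2)"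
  \<comment> \<open>For arbitrary a and b integrability may fail; the integral then has the default
    value 0.\<close>
  by (metis Henstock_Kurzweil_Integration.integral_nonneg not_integrable_integral order_refl zero_le_power2)+

text \<open>All three terms of the Lyapunov functional are nonnegative, so each is bounded alone.
  The last two lag one delay behind: information at time t is obtained from T = t + 1.\<close>

lemma lyapunov_bounds:
  assumes "0 \<le> T"
  shows "integral {T-1..T} (\<lambda>t. (w t)\<^sup>2) \<le> K"
    and "potential f (Y (T - 1)) \<le> K / (2 * (1 - \<gamma>))"
    and "integral {-1..T-1} (\<lambda>t. (f (Y t))\<^sup>2) \<le> K / (1 - \<gamma>\<^sup>2)"
proof -
  have nn: "0 \<le> 2 * (1 - \<gamma>) * potential f (Y (T - 1))"
    "0 \<le> (1 - \<gamma>\<^sup>2) * integral {-1..T-1} (\<lambda>t. (f (Y t))\<^sup>2)"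
    using \<gamma> one_minus_\<gamma>2_pos lyapunov_terms_nonneg(2) potential_nonneg by (intro mult_nonneg_nonneg; simp)+
  note l = lyapunov[OF assms] nn lyapunov_terms_nonneg(1)[of "T - 1" T]
  show "integral {T-1..T} (\<lambda>t. (w t)\<^sup>2) \<le> K" using l by linarith
  have "potential f (Y (T - 1)) * (2 * (1 - \<gamma>)) \<le> K" using l by (simp add: mult.commute)
  then show "potential f (Y (T - 1)) \<le> K / (2 * (1 - \<gamma>))" using \<gamma> by (subst pos_le_divide_eq) auto
  have "integral {-1..T-1} (\<lambda>t. (f (Y t))\<^sup>2) * (1 - \<gamma>\<^sup>2) \<le> K" using l by (simp add: mult.commute)
  then show "integral {-1..T-1} (\<lambda>t. (f (Y t))\<^sup>2) \<le> K / (1 - \<gamma>\<^sup>2)" using one_minus_\<gamma>2_pos by (subst pos_le_divide_eq) auto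
qed

section \<open>Uniform continuity and decay of the trajectory\<close>

lemma P2_window_le:
  assumes s: "0 \<le> s"
  shows "integral {s..s+1} (\<lambda>t. (P t)\<^sup>2) \<le> 2 * K + 2 * (K / (1 - \<gamma>\<^sup>2))"
proof -
  note i = absolutely_integrable_on_window[OF P2] absolutely_integrable_on_window[OF w2_integrable] absolutely_integrable_on_window[OF fY_gY_integrable(3)]
  have "integral {s..s+1} (\<lambda>t. (P t)\<^sup>2) \<le> integral {s..s+1} (\<lambda>t. 2 * (w t)\<^sup>2 + 2 * (f (Y t))\<^sup>2)"
  proof (rule integral_le)
    \<comment> \<open>\<open>P\<close> is \<open>w\<close> minus f(Y), and 2 w^2 + 2 f(Y)^2 - (w -
      f(Y))^2 = (w + f(Y))^2. Both squares on the right have integrals over unit windows bounded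
      independently of s.\<close>
    show "(P t)\<^sup>2 \<le> 2 * (w t)\<^sup>2 + 2 * (f (Y t))\<^sup>2" for t
      using zero_le_power2[of "w t + f (Y t)"] by (simp add: w_def power2_eq_square algebra_simps)
  qed (use s in \<open>intro set_lebesgue_integral_eq_integral(1) set_integral_add(1) set_integrable_mult_right i; simp\<close>)+
  also have "\<dots> = 2 * integral {s..s+1} (\<lambda>t. (w t)\<^sup>2) + 2 * integral {s..s+1} (\<lambda>t. (f (Y t))\<^sup>2)"
    using s by (intro integral_unique has_integral_add has_integral_mult_right integrable_integral
       set_lebesgue_integral_eq_integral(1) i) auto
  also have "integral {s..s+1} (\<lambda>t. (w t)\<^sup>2) \<le> K"
    using lyapunov_bounds(1)[of "s + 1"] s by simp
  also have "integral {s..s+1} (\<lambda>t. (f (Y t))\<^sup>2) \<le> integral {-1..s+1} (\<lambda>t. (f (Y t))\<^sup>2)"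
    using s by (intro integral_subset_le set_lebesgue_integral_eq_integral(1) i) auto
  also have "\<dots> \<le> K / (1 - \<gamma>\<^sup>2)"
    using lyapunov_bounds(3)[of "s + 2"] s by (simp add: algebra_simps)
  finally show ?thesis by simp
qed

text \<open>The two terms come from \<open>2 \<bar>P\<bar> \<le> l P\<^sup>2 + 1/l\<close>, which replaces the Cauchy--Schwarz inequality.\<close>

lemma Y_increment:
  assumes s: "0 \<le> s" and h: "0 \<le> h" "h \<le> 1" and l: "l > 0"
  shows "\<bar>Y (s + h) - Y s\<bar> \<le> l * (2 * K + 2 * (K / (1 - \<gamma>\<^sup>2))) + h / l"
proof -
  note i = absolutely_integrable_on_window[OF P1] absolutely_integrable_on_window[OF P2]
  have "Y (s + h) - Y s = integral {s..s+h} P"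
    using ac[of s "s + h"] s h by (simp add: integral_unique)
  also have "\<bar>\<dots>\<bar> \<le> integral {s..s+h} (\<lambda>t. l * (P t)\<^sup>2 + 1 / l)"
    unfolding real_norm_def[symmetric]
  proof (rule integral_norm_bound_integral)
    fix t
    have "2 * \<bar>P t\<bar> \<le> l * (P t)\<^sup>2 + 1 / l"
    proof -
      have "0 \<le> l * (\<bar>P t\<bar> - 1 / l)\<^sup>2" using l by simp
      also have "\<dots> = l * (P t)\<^sup>2 - 2 * \<bar>P t\<bar> + 1 / l"
        using l by (simp add: power2_eq_square field_simps)
      finally show ?thesis by simp
    qed
    then show "norm (P t) \<le> l * (P t)\<^sup>2 + 1 / l" by simp
  qed (use s in \<open>intro set_lebesgue_integral_eq_integral(1) set_integral_add(1) set_integrable_mult_right i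
     absolutely_integrable_on_const; simp\<close>)+
  also have "\<dots> = l * integral {s..s+h} (\<lambda>t. (P t)\<^sup>2) + h / l"
  proof (rule integral_unique)
    have "((\<lambda>_. 1 / l) has_integral h / l) {s..s+h}"
      using has_integral_const_real[of "1 / l" s "s + h"] h by simp
    then show "((\<lambda>t. l * (P t)\<^sup>2 + 1 / l) has_integral
        l * integral {s..s+h} (\<lambda>t. (P t)\<^sup>2) + h / l) {s..s+h}"
      using s by (intro has_integral_add has_integral_mult_right integrable_integral
          set_lebesgue_integral_eq_integral(1) i) auto
  qed
  also have "integral {s..s+h} (\<lambda>t. (P t)\<^sup>2) \<le> integral {s..s+1} (\<lambda>t. (P t)\<^sup>2)"
    using s h by (intro integral_subset_le set_lebesgue_integral_eq_integral(1) i) auto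
  also have "\<dots> \<le> 2 * K + 2 * (K / (1 - \<gamma>\<^sup>2))" by (rule P2_window_le[OF s])
  finally show ?thesis using l by simp
qed

text \<open>If |Y s| were at least e at a late time s, then |Y| would stay above e/2 on
  \<open>{s..s+h}\<close> with h independent of s. That window would contribute at least m h to the
  convergent integral of f(Y)^2, contradicting its Cauchy tails.\<close>

lemma Y_tendsto_0: "(Y \<longlongrightarrow> 0) at_top"
proof (rule tendstoI)
  fix e :: real assume e: "e > 0"
  define L where "L = 2 * K + 2 * (K / (1 - \<gamma>\<^sup>2))"
  have "K \<ge> 0" using lyapunov_bounds(1)[of 0] lyapunov_terms_nonneg(1)[of "-1" 0] by simp
  then have L: "L \<ge> 0" using one_minus_\<gamma>2_pos by (simp add: L_def)
  \<comment> \<open>With \<open>l\<close> the first term of \<open>Y_increment\<close> is at most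
    e/4, and with \<open>h\<close> the second one is; together Y moves by at most e/2. The 1 added
    to L avoids a division by zero.\<close>
  define l where "l = e / (4 * (L + 1))"
  have l: "l > 0" "l * L \<le> e / 4" using e L by (auto simp: l_def field_simps)
  define h where "h = min 1 (l * e / 4)"
  have h: "0 < h" "h \<le> 1" using l e by (auto simp: h_def)
  have "h \<le> (e / 4) * l" by (simp add: h_def mult.commute)
  then have hl: "h / l \<le> e / 4" using l(1) by (simp add: pos_divide_le_eq)
  \<comment> \<open>By monotonicity, f^2 outside (-e/2, e/2) is bounded below by its smaller value
    at the two endpoints.\<close>
  define m where "m = min ((f (e / 2))\<^sup>2) ((f (- e / 2))\<^sup>2)"
  have "f (e / 2) > 0" "f (- e / 2) < 0" using f_sgn e by auto
  then have m: "m > 0" by (auto simp: m_def)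
  have fm: "m \<le> (f z)\<^sup>2" if "\<bar>z\<bar> \<ge> e / 2" for z
  proof (cases "z > 0")
    case True
    then have "f (e / 2) \<le> f z" using that f_mono by (simp add: strict_mono_less_eq)
    then have "(f (e / 2))\<^sup>2 \<le> (f z)\<^sup>2" using \<open>f (e / 2) > 0\<close> by (intro power_mono) auto
    then show ?thesis by (simp add: m_def)
  next
    case False
    then have "f z \<le> f (- e / 2)" using that f_mono by (simp add: strict_mono_less_eq)
    then have "(- f (- e / 2))\<^sup>2 \<le> (- f z)\<^sup>2" using \<open>f (- e / 2) < 0\<close> by (intro power_mono) auto
    then show ?thesis by (simp add: m_def)
  qed
  define J where "J = (\<lambda>T. integral {-1..T} (\<lambda>t. (f (Y t))\<^sup>2))"
  note i = absolutely_integrable_on_window[OF fY_gY_integrable(3)]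
  have Jmono: "J s \<le> J t" if "s \<le> t" for s t
    unfolding J_def using that by (intro integral_subset_le set_lebesgue_integral_eq_integral(1) i) auto
  have Jle: "J (real n) \<le> K / (1 - \<gamma>\<^sup>2)" for n
    using lyapunov_bounds(3)[of "real n + 1"] by (simp add: J_def)
  have "incseq (\<lambda>n. J (real n))" using Jmono by (simp add: incseq_def)
  then have "convergent (\<lambda>n. J (real n))"
    using Jle by (meson convergent_def incseq_convergent)
  then have "Cauchy (\<lambda>n. J (real n))" by (rule convergent_Cauchy)
  moreover have "m * h > 0" using m h by simp
  ultimately obtain N where N: "\<And>p n. p \<ge> N \<Longrightarrow> n \<ge> N \<Longrightarrow> norm (J (real p) - J (real n)) < m * h"
    using CauchyD by blast
  \<comment> \<open>The Cauchy property is known at integer times; since J is monotone, rounding t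
    up and s down to integers extends it to real times.\<close>
  have tail: "J t - J s < m * h" if st: "real N \<le> s" "s \<le> t" for s t
  proof -
    obtain p where p: "t \<le> real p" using real_arch_simple by blast
    then have "p \<ge> N" using st by linarith
    have "J t - J s \<le> J (real p) - J (real N)" using Jmono[of t "real p"] Jmono[of "real N" s] p st by linarith
    also have "\<dots> < m * h" using N[OF \<open>p \<ge> N\<close> order_refl] by simp
    finally show ?thesis .
  qed
  show "\<forall>\<^sub>F t in at_top. dist (Y t) 0 < e"
  proof (rule eventually_at_top_linorderI[of "real N"])
    fix s assume s: "real N \<le> s"
    then have s0: "0 \<le> s" by linarith
    show "dist (Y s) 0 < e"
    proof (rule ccontr)
      assume "\<not> dist (Y s) 0 < e"
      then have Ys: "\<bar>Y s\<bar> \<ge> e" by simp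
      have "m \<le> (f (Y t))\<^sup>2" if "t \<in> {s..s+h}" for t
      proof (rule fm)
        have "\<bar>Y (s + (t - s)) - Y s\<bar> \<le> l * L + (t - s) / l"
          unfolding L_def using that h s0 l by (intro Y_increment) auto
        moreover have "(t - s) / l \<le> h / l" using that l by (intro divide_right_mono) auto
        moreover have "s + (t - s) = t" by simp
        ultimately have "\<bar>Y t - Y s\<bar> \<le> e / 2" using l(2) hl by (simp only:)
        then show "e / 2 \<le> \<bar>Y t\<bar>" using Ys by linarith
      qed
      then have "integral {s..s+h} (\<lambda>_. m) \<le> integral {s..s+h} (\<lambda>t. (f (Y t))\<^sup>2)"
        using s0 by (intro integral_le set_lebesgue_integral_eq_integral(1) i) auto
      moreover have "integral {s..s+h} (\<lambda>_. m) = m * h" using h by simp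
      moreover have "J s + integral {s..s+h} (\<lambda>t. (f (Y t))\<^sup>2) = J (s + h)"
        unfolding J_def using s0 h by (intro Henstock_Kurzweil_Integration.integral_combine
            set_lebesgue_integral_eq_integral(1) i) auto
      ultimately show False using tail[OF s, of "s + h"] h by linarith
    qed
  qed
qed

section \<open>The bounds as nonnegative extended integrals\<close>

lemma f2_nn_integral: "(\<integral>\<^sup>+t\<in>{0<..}. ennreal ((f (Y t))\<^sup>2) \<partial>lebesgue) \<le> ennreal (K / (1 - \<gamma>\<^sup>2))"
proof -
  \<comment> \<open>The half-line is exhausted by bounded intervals on which the Lyapunov bound is
    uniform; monotone convergence gives the limit.\<close>
  let ?u = "\<lambda>n::nat. \<lambda>t. ennreal ((f (Y t))\<^sup>2) * indicator {0<..real n} t"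
  have eq: "(\<integral>\<^sup>+t. ?u n t \<partial>lebesgue) = ennreal (integral {0<..real n} (\<lambda>t. (f (Y t))\<^sup>2))" for n
  proof -
    have i: "(\<lambda>t. (f (Y t))\<^sup>2) absolutely_integrable_on {0<..real n}"
      by (rule set_integrable_subset[OF fY_gY_integrable(3)[of "real n"]]) auto
    have "(\<integral>\<^sup>+t. ?u n t \<partial>lebesgue) = (\<integral>\<^sup>+t. ennreal (indicator {0<..real n} t *\<^sub>R (f (Y t))\<^sup>2) \<partial>lebesgue)"
      by (rule nn_integral_cong) (auto simp: indicator_def)
    also have "\<dots> = ennreal (LINT t:{0<..real n}|lebesgue. (f (Y t))\<^sup>2)"
      using i unfolding set_lebesgue_integral_def set_integrable_def by (intro nn_integral_eq_integral) auto
    finally show ?thesis by (simp add: set_lebesgue_integral_eq_integral(2)[OF i])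
  qed
  have le: "(\<integral>\<^sup>+t. ?u n t \<partial>lebesgue) \<le> ennreal (K / (1 - \<gamma>\<^sup>2))" for n
  proof -
    have "integral {0<..real n} (\<lambda>t. (f (Y t))\<^sup>2) \<le> integral {-1..real n} (\<lambda>t. (f (Y t))\<^sup>2)"
      by (intro integral_subset_le set_lebesgue_integral_eq_integral(1) fY_gY_integrable
         set_integrable_subset[OF fY_gY_integrable(3)[of "real n"]]) auto
    also have "\<dots> \<le> K / (1 - \<gamma>\<^sup>2)" using lyapunov_bounds(3)[of "real n + 1"] by simp
    finally show ?thesis unfolding eq by (rule ennreal_leI)
  qed
  have SUP: "(SUP n. ?u n t) = ennreal ((f (Y t))\<^sup>2) * indicator {0<..} t" for t
  proof (rule antisym)
    show "(SUP n. ?u n t) \<le> ennreal ((f (Y t))\<^sup>2) * indicator {0<..} t"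
      by (rule SUP_least) (auto simp: indicator_def)
    obtain n where "t \<le> real n" using real_arch_simple by blast
    then have "ennreal ((f (Y t))\<^sup>2) * indicator {0<..} t = ?u n t" by (auto simp: indicator_def)
    also have "\<dots> \<le> (SUP n. ?u n t)" by (rule SUP_upper) simp
    finally show "ennreal ((f (Y t))\<^sup>2) * indicator {0<..} t \<le> (SUP n. ?u n t)" .
  qed
  have "(\<integral>\<^sup>+t\<in>{0<..}. ennreal ((f (Y t))\<^sup>2) \<partial>lebesgue) = (\<integral>\<^sup>+t. (SUP n. ?u n t) \<partial>lebesgue)"
    by (simp only: SUP)
  also have "\<dots> = (SUP n. \<integral>\<^sup>+t. ?u n t \<partial>lebesgue)"
  proof (rule nn_integral_monotone_convergence_SUP)
    show "incseq ?u"
      by (auto simp: incseq_def le_fun_def indicator_def)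
    fix n
    have "(\<lambda>t. indicator {0<..real n} t *\<^sub>R (f (Y t))\<^sup>2) \<in> borel_measurable lebesgue"
      by (intro borel_measurable_integrable, fold set_integrable_def)
        (rule set_integrable_subset[OF fY_gY_integrable(3)[of "real n"]]; force)
    then have "(\<lambda>t. ennreal (indicator {0<..real n} t *\<^sub>R (f (Y t))\<^sup>2)) \<in> borel_measurable lebesgue"
      by (intro measurable_compose[OF _ measurable_ennreal])
    moreover have "(\<lambda>t. ennreal (indicator {0<..real n} t *\<^sub>R (f (Y t))\<^sup>2)) = ?u n"
      by (auto simp: indicator_def)
    ultimately show "?u n \<in> borel_measurable lebesgue" by (simp only:)
  qed
  also have "\<dots> \<le> ennreal (K / (1 - \<gamma>\<^sup>2))" by (rule SUP_least) (rule le)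
  finally show ?thesis .
qed

lemma energy_le:
  assumes "0 \<le> T"
  shows "energy f Y P T \<le> ennreal K"
proof -
  have i: "(\<lambda>t. (w t)\<^sup>2) absolutely_integrable_on {T-1..T}"
    by (rule absolutely_integrable_on_window[OF w2_integrable]) (use assms in simp)
  have "energy f Y P T = (\<integral>\<^sup>+t. ennreal (indicator {T-1..T} t *\<^sub>R (w t)\<^sup>2) \<partial>lebesgue)"
    unfolding energy_def w_def by (rule nn_integral_cong) (auto simp: indicator_def)
  also have "\<dots> = ennreal (LINT t:{T-1..T}|lebesgue. (w t)\<^sup>2)"
    using i unfolding set_lebesgue_integral_def set_integrable_def by (intro nn_integral_eq_integral) auto
  also have "\<dots> \<le> ennreal K"
    unfolding set_lebesgue_integral_eq_integral(2)[OF i] by (rule ennreal_leI[OF lyapunov_bounds(1)[OF assms]])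
  finally show ?thesis .
qed

end

section \<open>The regularity of the solution\<close>

text \<open>On a set of finite measure the integrable function 1 + u^2 dominates |u|.\<close>

lemma L2_on_imp_set_integrable:
  assumes "L2_on S u" "S \<in> lmeasurable"
  shows "set_integrable lebesgue S u"
  unfolding set_integrable_def
proof (rule Bochner_Integration.integrable_bound)
  show "integrable lebesgue (\<lambda>x. indicator S x *\<^sub>R 1 + indicator S x *\<^sub>R (u x)\<^sup>2)"
    using assms unfolding L2_on_def set_integrable_def
    by (intro Bochner_Integration.integrable_add) (auto simp: fmeasurable_def)
  show "(\<lambda>x. indicator S x *\<^sub>R u x) \<in> borel_measurable lebesgue"
    using assms by (simp add: L2_on_def set_borel_measurable_def)
  have "\<bar>x\<bar> \<le> 1 + x\<^sup>2" for x :: real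
    using zero_le_power2[of "\<bar>x\<bar> - 1"] abs_ge_zero[of x] by (simp add: power2_eq_square algebra_simps)
  then show "AE x in lebesgue. norm (indicator S x *\<^sub>R u x) \<le>
      norm (indicator S x *\<^sub>R 1 + indicator S x *\<^sub>R (u x)\<^sup>2)"
    by (intro AE_I2) (auto simp: indicator_def)
qed

lemma absolutely_integrable_AE_cong:
  fixes u v :: "real \<Rightarrow> real"
  assumes "u absolutely_integrable_on S" "AE x in lebesgue. x \<in> S \<longrightarrow> v x = u x"
  shows "v absolutely_integrable_on S"
proof -
  obtain N where N: "\<And>x. x \<in> space lebesgue - N \<Longrightarrow> x \<in> S \<longrightarrow> v x = u x" "N \<in> null_sets lebesgue"
    using assms(2) by (rule AE_E3) (rule that)
  show ?thesis
    by (rule absolutely_integrable_spike[OF assms(1)]) (use N in \<open>auto simp: negligible_iff_null_sets\<close>)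
qed

text \<open>Local regularity on the open half-line says nothing near -1. There \<open>y'\<close>
  coincides almost everywhere with the square integrable derivative of the initial datum, which
  supplies the missing control.\<close>

lemma delay_derivative_integrable:
  assumes y0: "H1_on {-1<..<0} y0" and y: "H1_loc {-1<..} y" "weak_derivative_on {-1<..} y y'"
    and eq: "\<And>t. -1 < t \<Longrightarrow> t < 0 \<Longrightarrow> y t = y0 t"
  shows "y' absolutely_integrable_on {-1..T}" "(\<lambda>t. (y' t)\<^sup>2) absolutely_integrable_on {-1..T}"
proof -
  have cont: "continuous_on {-1<..} y" using y(1) by (simp add: H1_loc_def)
  obtain v0 where v0: "weak_derivative_on {-1<..<0} y0 v0" "L2_on {-1<..<0} v0"
    using y0 by (auto simp: H1_on_def)
  obtain v where v: "weak_derivative_on {-1<..} y v" "L2_loc {-1<..} v"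
    using y(1) by (auto simp: H1_loc_def)
  have "AE t in lebesgue. t \<in> {-1<..<0} \<longrightarrow> v0 t = y' t"
    by (rule weak_derivative_unique[OF v0(1) y(2) _ _ _ cont]) (use eq in auto)
  then have ae0: "AE t in lebesgue. t \<in> {-1<..<0} \<longrightarrow> y' t = v0 t" by eventually_elim simp
  have "AE t in lebesgue. t \<in> {-1<..} \<longrightarrow> y' t = v t"
    by (rule weak_derivative_unique[OF y(2) v(1) _ _ _ cont]) auto
  \<comment> \<open>The point -1/2 is an arbitrary choice inside (-1,0): \<open>{-1/2..T}\<close> is
    compact in the open half-line, and together with (-1,0) and the point -1 it covers
    \<open>{-1..T}\<close>.\<close>
  then have ae1: "AE t in lebesgue. t \<in> {-1/2..T} \<longrightarrow> y' t = v t" by eventually_elim auto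
  have "L2_on {-1/2..T} v" using v(2) by (simp add: L2_loc_def subset_eq)
  then have i: "v0 absolutely_integrable_on {-1<..<0}" "(\<lambda>t. (v0 t)\<^sup>2) absolutely_integrable_on {-1<..<0}"
    "v absolutely_integrable_on {-1/2..T}" "(\<lambda>t. (v t)\<^sup>2) absolutely_integrable_on {-1/2..T}"
    using L2_on_imp_set_integrable v0(2) by (auto simp: L2_on_def)
  have join: "u absolutely_integrable_on {-1..T}"
    if "u absolutely_integrable_on {-1<..<0}" "u absolutely_integrable_on {-1/2..T}" for u :: "real \<Rightarrow> real"
  proof -
    have "u absolutely_integrable_on {-1}" by (rule absolutely_integrable_negligible) simp
    with that have "u absolutely_integrable_on ({-1} \<union> ({-1<..<0} \<union> {-1/2..T}))"
      by (intro set_integrable_Un) auto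
    then show ?thesis by (rule set_integrable_subset) auto
  qed
  show "y' absolutely_integrable_on {-1..T}"
    by (rule join[OF absolutely_integrable_AE_cong[OF i(1) ae0] absolutely_integrable_AE_cong[OF i(3) ae1]])
  show "(\<lambda>t. (y' t)\<^sup>2) absolutely_integrable_on {-1..T}"
  proof (rule join[OF absolutely_integrable_AE_cong[OF i(2)] absolutely_integrable_AE_cong[OF i(4)]])
    show "AE t in lebesgue. t \<in> {-1<..<0} \<longrightarrow> (y' t)\<^sup>2 = (v0 t)\<^sup>2" using ae0 by eventually_elim simp
    show "AE t in lebesgue. t \<in> {-1/2..T} \<longrightarrow> (y' t)\<^sup>2 = (v t)\<^sup>2" using ae1 by eventually_elim simp
  qed
qed

section \<open>Transfer from the extended trajectory to the solution\<close>

theorem theorem1: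
  fixes c \<gamma> :: real and f g y0 y y' :: "real \<Rightarrow> real"
  assumes "c \<in> {-1, 1}"
    and "f C1_differentiable_on UNIV" and "\<And>x. deriv f x > 0" and "f 0 = 0"
    and "g \<in> borel_measurable borel"
    and "0 \<le> \<gamma>" and "\<gamma> < 1" and "\<And>x. \<bar>g x\<bar> \<le> \<gamma> * \<bar>f x\<bar>"
    and "H1_on {-1<..<0} y0"
    and "H1_loc {-1<..} y"
    and "weak_derivative_on {-1<..} y y'"
    and "AE t in lebesgue. t > 0 \<longrightarrow> y' t + c * y' (t - 1) + f (y t) + g (y (t - 1)) = 0"
    and "\<And>t. -1 < t \<Longrightarrow> t < 0 \<Longrightarrow> y t = y0 t"
  shows "(SUP t\<in>{0<..}. enn2ereal (energy f y y' t)) + (SUP t\<in>{0<..}. ereal (potential f (y t)))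
           + enn2ereal (\<integral>\<^sup>+t\<in>{0<..}. ennreal ((f (y t))\<^sup>2) \<partial>lebesgue) < \<infinity>
         \<and> (y \<longlongrightarrow> 0) at_top"
proof -
  have f': "(f has_real_derivative deriv f x) (at x)" for x
    using assms(2) by (auto simp: C1_differentiable_on_def DERIV_deriv_iff_has_field_derivative
        simp flip: has_real_derivative_iff_has_vector_derivative dest: DERIV_imp_deriv)
  have f_cont: "continuous_on UNIV f"
    by (rule DERIV_continuous_on) (rule has_field_derivative_at_within[OF f'])
  have f_mono: "strict_mono f"
  proof (rule strict_monoI)
    show "f a < f b" if "a < b" for a b
      using DERIV_pos_imp_increasing[OF that, of f] f' assms(3) by blast
  qed
  have cont: "continuous_on {-1<..} y" using assms(10) by (simp add: H1_loc_def)
  note int = delay_derivative_integrable[OF assms(9,10,11,13)]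
  \<comment> \<open>The primitive of \<open>y'\<close> on the closed half-line, normalised to agree
    with y at 0; it extends the solution continuously to -1.\<close>
  define Y where "Y = (\<lambda>t. y 0 - integral {-1..0} y' + integral {-1..t} y')"
  have y'i: "y' integrable_on {-1..T}" for T
    by (rule set_lebesgue_integral_eq_integral(1)[OF int(1)])
  have comb: "integral {-1..s} y' + integral {s..t} y' = integral {-1..t} y'" if "-1 \<le> s" "s \<le> t" for s t
    using that by (intro Henstock_Kurzweil_Integration.integral_combine y'i)
  have Y: "Y t = y t" if t: "t > -1" for t
  proof (cases "0 \<le> t")
    case True
    have "integral {0..t} y' = y t - y 0"
      by (intro integral_unique weak_derivative_integral[OF assms(11) _ cont]) (use True in auto)
    then show ?thesis using comb[of 0 t] True by (simp add: Y_def)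
  next
    case False
    have "integral {t..0} y' = y 0 - y t"
      by (intro integral_unique weak_derivative_integral[OF assms(11) _ cont]) (use False t in auto)
    then show ?thesis using comb[of t 0] False t by (simp add: Y_def)
  qed
  interpret delay_trajectory c \<gamma> f g y' Y
  proof
    show "c\<^sup>2 = 1" using assms(1) by auto
    show "(y' has_integral Y t - Y s) {s..t}" if "-1 \<le> s" "s \<le> t" for s t
    proof -
      have "y' integrable_on {s..t}"
        by (rule integrable_on_subinterval[OF y'i[of t]]) (use that in auto)
      moreover have "integral {s..t} y' = Y t - Y s" using comb[OF that] by (simp add: Y_def)
      ultimately show ?thesis by (metis integrable_integral)
    qed
    show "AE t in lebesgue. t > 0 \<longrightarrow> y' t + c * y' (t - 1) + f (Y t) + g (Y (t - 1)) = 0"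
      using assms(12) by eventually_elim (simp add: Y)
    show "(\<lambda>t. (y' t)\<^sup>2) absolutely_integrable_on {-1..T}" for T by (rule int(2))
  qed (fact f_cont f_mono assms | rule int(1))+
  have "(SUP t\<in>{0<..}. enn2ereal (energy f y y' t)) \<le> enn2ereal (ennreal K)"
  proof (rule SUP_least)
    fix t :: real assume t: "t \<in> {0<..}"
    \<comment> \<open>For t > 0 the window \<open>{t - 1..t}\<close> lies strictly to the right of
      -1, where Y and y agree.\<close>
    have "energy f y y' t = energy f Y y' t"
      unfolding energy_def by (rule nn_integral_cong) (use t Y in \<open>auto simp: indicator_def\<close>)
    then show "enn2ereal (energy f y y' t) \<le> enn2ereal (ennreal K)"
      using energy_le[of t] t by (simp add: less_eq_ennreal.rep_eq)
  qed
  then have 1: "(SUP t\<in>{0<..}. enn2ereal (energy f y y' t)) < \<infinity>"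
    by (rule order_le_less_trans) (use ennreal_less_top[of K] in \<open>simp add: less_ennreal.rep_eq\<close>)
  have "(SUP t\<in>{0<..}. ereal (potential f (y t))) \<le> ereal (K / (2 * (1 - \<gamma>)))"
  proof (rule SUP_least)
    fix t :: real assume t: "t \<in> {0<..}"
    then show "ereal (potential f (y t)) \<le> ereal (K / (2 * (1 - \<gamma>)))"
      using lyapunov_bounds(2)[of "t + 1"] Y[of t] by simp
  qed
  then have 2: "(SUP t\<in>{0<..}. ereal (potential f (y t))) < \<infinity>"
    by (rule order_le_less_trans) simp
  have "(\<integral>\<^sup>+t\<in>{0<..}. ennreal ((f (y t))\<^sup>2) \<partial>lebesgue) = (\<integral>\<^sup>+t\<in>{0<..}. ennreal ((f (Y t))\<^sup>2) \<partial>lebesgue)"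
    by (rule nn_integral_cong) (use Y in \<open>auto simp: indicator_def\<close>)
  also have "\<dots> < \<infinity>" using order_le_less_trans[OF f2_nn_integral] by simp
  finally have 3: "enn2ereal (\<integral>\<^sup>+t\<in>{0<..}. ennreal ((f (y t))\<^sup>2) \<partial>lebesgue) < \<infinity>"
    by (simp add: less_ennreal.rep_eq)
  have "\<forall>\<^sub>F t in at_top. Y t = y t"
    using eventually_gt_at_top[of "-1"] by eventually_elim (rule Y)
  then have "(y \<longlongrightarrow> 0) at_top" by (rule Lim_transform_eventually[OF Y_tendsto_0])
  \<comment> \<open>In \<open>ereal\<close> a sum is below infinity exactly when every summand
    is.\<close>
  with 1 2 3 show ?thesis by simp
qed

end
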